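(* Let $q$ be a prime power, let $d\geqslant 1$, and let $\mathcal{C}$ be an irreducible algebraic curve of degree $d$ over $\mathbb{F}_q[T]$, i.e. $\mathcal{C}$ is given by $F(X,Y)=0$ where $F\in(\mathbb{F}_q[T])[X,Y]$ is irreducible of total degree $d$ in $X,Y$. For an integer $n\geqslant 0$ let $I$ be the set of polynomials $X\in\mathbb{F}_q[T]$ with $\deg X\leqslant n$, so $|I|=q^{n+1}$, and let $S=\{(X,Y)\in I^2: F(X,Y)=0\}$ be the set of points of $\mathcal{C}$ inside $I^2$. Then for every $\varepsilon>0$, $$|S|\ll_{d,\varepsilon}|I|^{\frac{1}{d}+\varepsilon},$$ where the implied constant depends only on $d$ and $\varepsilon$ (not on $F$ or $n$).
   Context: $|I|$ denotes the number of elements of $I$. The notation $A\ll_{d,\varepsilon}B$ means $A\leqslant cB$ for a constant $c$ depending only on $d,\varepsilon$.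
   Formalization: The implied constant is allowed to depend on q as well as on d and ε (still not on F or n); independence of q is impossible: for n=0, F=Y−X^d with d≥2 one has |S|=q=|I|, which violates the bound for small ε as q grows. *)

theory Defs
  imports Complex_Main
    "HOL-Computational_Algebra.Computational_Algebra"
    "HOL-Library.Cardinality"
begin

text \<open>
  A finite field with q elements is a type \<open>'k :: {field, finite}\<close> with q = CARD('k);
  \<open>'k poly\<close> is F_q[T]. A bivariate polynomial over a ring \<open>'a\<close> has type
  \<open>'a poly poly\<close>: a polynomial in Y whose coefficients are polynomials in X, so that
  \<open>coeff (coeff F j) i\<close> is the coefficient of X^i Y^j. In particular
  \<open>F :: 'k poly poly poly\<close> is an element of (F_q[T])[X,Y].
\<close>

definition eval2 :: "'a::comm_ring_1 poly poly \<Rightarrow> 'a \<Rightarrow> 'a \<Rightarrow> 'a" where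
  "eval2 F x y = poly (poly F [:y:]) x"

definition total_degree2 :: "'a::zero poly poly \<Rightarrow> nat" where
  "total_degree2 F = Max (insert 0 {i + j | i j. coeff (coeff F j) i \<noteq> 0})"

text \<open>Since \<open>degree 0 = 0\<close>, the zero polynomial belongs to \<open>poly_box n\<close>.\<close>

definition poly_box :: "nat \<Rightarrow> 'k::zero poly set" where
  "poly_box n = {p. degree p \<le> n}"

definition curve_points :: "'k::comm_ring_1 poly poly poly \<Rightarrow> nat \<Rightarrow> ('k poly \<times> 'k poly) set" where
  "curve_points F n = {(x, y). x \<in> poly_box n \<and> y \<in> poly_box n \<and> eval2 F x y = 0}"

lemma eval2_altdef:
  "eval2 F x y = (\<Sum>j\<le>degree F. \<Sum>i\<le>degree (coeff F j). coeff (coeff F j) i * x ^ i * y ^ j)"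
  by (simp add: eval2_def poly_altdef[of F] poly_sum poly_altdef[of "coeff F _"]
      sum_distrib_right)

lemma finite_total_degree2_set: "finite {i + j | i j. coeff (coeff F j) i \<noteq> 0}"
proof -
  have "{i + j | i j. coeff (coeff F j) i \<noteq> 0}
      \<subseteq> (\<Union>j\<le>degree F. (\<lambda>i. i + j) ` {..degree (coeff F j)})"
  proof
    fix m assume "m \<in> {i + j | i j. coeff (coeff F j) i \<noteq> 0}"
    then obtain i j where m: "m = i + j" and ij: "coeff (coeff F j) i \<noteq> 0" by auto
    from ij have "i \<le> degree (coeff F j)" by (rule le_degree)
    moreover from ij have "j \<le> degree F" by (intro le_degree) auto
    ultimately show "m \<in> (\<Union>j\<le>degree F. (\<lambda>i. i + j) ` {..degree (coeff F j)})"
      using m by blast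
  qed
  then show ?thesis by (rule finite_subset) auto
qed

lemma poly_box_0: "poly_box 0 = range (\<lambda>a. [:a:])"
  by (auto simp: poly_box_def elim: degree_eq_zeroE)

lemma poly_box_Suc: "poly_box (Suc n) = (\<lambda>(a, p). pCons a p) ` (UNIV \<times> poly_box n)"
proof (intro equalityI subsetI)
  fix p :: "'a poly" assume p: "p \<in> poly_box (Suc n)"
  obtain a r where "p = pCons a r" by (cases p)
  then show "p \<in> (\<lambda>(a, p). pCons a p) ` (UNIV \<times> poly_box n)"
    using p by (auto simp: poly_box_def degree_pCons_eq_if split: if_splits)
qed (auto simp: poly_box_def degree_pCons_eq_if)

lemma finite_poly_box: "finite (poly_box n :: 'k::{zero,finite} poly set)"
  by (induction n) (simp_all add: poly_box_0 poly_box_Suc)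

lemma card_poly_box: "card (poly_box n :: 'k::{zero,finite} poly set) = CARD('k) ^ (n + 1)"
proof (induction n)
  case 0
  then show ?case by (simp add: poly_box_0 card_image inj_on_def)
next
  case (Suc n)
  have "inj_on (\<lambda>(a, p). pCons a p) (UNIV \<times> (poly_box n :: 'k poly set))"
    by (auto simp: inj_on_def)
  then show ?case using Suc by (simp add: poly_box_Suc card_image card_cartesian_product)
qed

lemma finite_curve_points: "finite (curve_points (F :: 'k::{field,finite} poly poly poly) n)"
  by (rule finite_subset[of _ "poly_box n \<times> poly_box n"])
    (auto simp: curve_points_def finite_poly_box)

end

theory Submission
  imports Defs
    "HOL-Computational_Algebra.Field_as_Ring"
    "HOL-Real_Asymp.Real_Asymp"
    "Jordan_Normal_Form.Determinant"
begin

text \<open>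
  The proof is the \<open>P\<close>-adic determinant method of Heath-Brown, with the determinants replaced by
  the pigeonhole principle. After a shear \<open>X \<mapsto> X + l Y\<close> one may assume that \<open>F\<close> contains \<open>Y ^ d\<close>
  and that \<open>\<partial>F/\<partial>Y \<noteq> 0\<close>; if both partial derivatives vanish, differentiating \<open>F(x(T), y(T)) = 0\<close>
  with respect to \<open>T\<close> puts all points on a second curve. If there are more than \<open>O\<^sub>d(1)\<close> points,
  then interpolation through them bounds the height of \<open>F\<close> linearly in \<open>n\<close>, so that every point
  with \<open>\<partial>F/\<partial>Y \<noteq> 0\<close> is nonsingular modulo one of boundedly many primes \<open>P\<close> whose degree is
  slightly larger than \<open>n / d\<close>. Modulo \<open>P\<close> the curve has at most \<open>d * q ^ degree P\<close> points, and
  the points of the box above a given nonsingular one are zeros of an auxiliary polynomial of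
  bounded degree which is not divisible by \<open>F\<close>, hence there are boundedly many of them.
\<close>

text \<open>The exponent \<open>1 / d\<close> is the outcome of a parameter count. The auxiliary
  polynomial uses the monomials \<open>X ^ i * Y ^ j\<close> with \<open>i < A\<close> and
  \<open>j < d\<close>; the bound \<open>j < d\<close> is what rules out divisibility by
  \<open>F\<close>, while \<open>A\<close> may grow. With \<open>M = d * A\<close> and
  \<open>\<mu> = degree P\<close>, its coefficients offer at least
  \<open>M ^ 2 * \<mu> - n * M * (A + d - 2) / 2\<close> free elements of the field, and vanishing
  modulo \<open>P ^ M\<close> on a disc imposes \<open>\<mu> * M * (M + 1) / 2\<close> conditions.
  There is room as soon as \<open>n * (A + d - 2) < \<mu> * (M - 1)\<close>, and for large
  \<open>A\<close> this asks for \<open>\<mu> / n\<close> just above \<open>1 / d\<close>. The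
  obstacle is uniformity in \<open>F\<close>, whose coefficients may have any degree in
  \<open>T\<close>: without the height bound, the number of primes needed to avoid bad reduction
  would depend on \<open>F\<close>. Primes are not counted precisely; it suffices that enough of
  them have degree between \<open>(1 / d + \<epsilon> / 2) * n\<close> and
  \<open>(1 / d + \<epsilon>) * n\<close>, which is where \<open>\<epsilon>\<close> is
  spent.\<close>

section \<open>Fields with trivial gcd structure\<close>

text \<open>Unique factorization of polynomials is available only over types of class
  \<^class>\<open>field_gcd\<close>; an arbitrary field is replaced by the following copy of it.\<close>

typedef (overloaded) 'a gcd_field = "UNIV :: 'a set" by auto

setup_lifting type_definition_gcd_field

instantiation gcd_field :: (field) field
begin
lift_definition zero_gcd_field :: "'a gcd_field" is 0 .
lift_definition one_gcd_field :: "'a gcd_field" is 1 .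
lift_definition plus_gcd_field :: "'a gcd_field \<Rightarrow> 'a gcd_field \<Rightarrow> 'a gcd_field" is "(+)" .
lift_definition minus_gcd_field :: "'a gcd_field \<Rightarrow> 'a gcd_field \<Rightarrow> 'a gcd_field" is "(-)" .
lift_definition uminus_gcd_field :: "'a gcd_field \<Rightarrow> 'a gcd_field" is uminus .
lift_definition times_gcd_field :: "'a gcd_field \<Rightarrow> 'a gcd_field \<Rightarrow> 'a gcd_field" is "(*)" .
lift_definition inverse_gcd_field :: "'a gcd_field \<Rightarrow> 'a gcd_field" is inverse .
lift_definition divide_gcd_field :: "'a gcd_field \<Rightarrow> 'a gcd_field \<Rightarrow> 'a gcd_field" is "(/)" .
instance
  by standard (transfer; simp add: field_simps)+
end

instance gcd_field :: (finite) finite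
proof
  have "(UNIV :: 'a gcd_field set) = range Abs_gcd_field"
    by (metis Rep_gcd_field_inverse surj_def)
  thus "finite (UNIV :: 'a gcd_field set)" by (metis finite_imageI finite)
qed

instantiation gcd_field :: (field)
  "{unique_euclidean_ring, normalization_euclidean_semiring, normalization_semidom_multiplicative}"
begin
definition [simp]: "normalize_gcd_field = (normalize_field :: 'a gcd_field \<Rightarrow> _)"
definition [simp]: "unit_factor_gcd_field = (unit_factor_field :: 'a gcd_field \<Rightarrow> _)"
definition [simp]: "modulo_gcd_field = (mod_field :: 'a gcd_field \<Rightarrow> _)"
definition [simp]: "euclidean_size_gcd_field = (euclidean_size_field :: 'a gcd_field \<Rightarrow> _)"
definition [simp]: "division_segment (x :: 'a gcd_field) = 1"
instance
  by standard
    (simp_all add: dvd_field_iff field_split_simps split: if_splits)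
end

instantiation gcd_field :: (field) euclidean_ring_gcd
begin
definition gcd_gcd_field :: "'a gcd_field \<Rightarrow> 'a gcd_field \<Rightarrow> 'a gcd_field" where
  "gcd_gcd_field = Euclidean_Algorithm.gcd"
definition lcm_gcd_field :: "'a gcd_field \<Rightarrow> 'a gcd_field \<Rightarrow> 'a gcd_field" where
  "lcm_gcd_field = Euclidean_Algorithm.lcm"
definition Gcd_gcd_field :: "'a gcd_field set \<Rightarrow> 'a gcd_field" where
  "Gcd_gcd_field = Euclidean_Algorithm.Gcd"
definition Lcm_gcd_field :: "'a gcd_field set \<Rightarrow> 'a gcd_field" where
  "Lcm_gcd_field = Euclidean_Algorithm.Lcm"
instance
  by standard (simp_all add: gcd_gcd_field_def lcm_gcd_field_def Gcd_gcd_field_def Lcm_gcd_field_def)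
end

instance gcd_field :: (field) field_gcd ..

instance gcd_field :: ("{field, finite}") finite_field
  by (rule finite_fieldI) simp

section \<open>Common zeros of two plane curves\<close>

hide_const (open) Module.smult
no_notation fps_nth (infixl \<open>$\<close> 75)

lemma sum_lessThan_plus:
  fixes f :: "nat \<Rightarrow> 'a::comm_monoid_add"
  shows "(\<Sum>i<m + n. f i) = (\<Sum>i<m. f i) + (\<Sum>i<n. f (m + i))"
  by (induction n) (simp_all add: add_ac)

lemma eval2_eq_sum:
  assumes "degree F < n"
  shows "eval2 F x y = (\<Sum>j<n. poly (coeff F j) x * y ^ j)"
proof -
  have "poly F [:y:] = (\<Sum>j<n. coeff F j * [:y:] ^ j)"
    unfolding poly_altdef using assms
    by (intro sum.mono_neutral_left) (auto simp: coeff_eq_0)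
  then show ?thesis
    by (simp add: eval2_def poly_sum)
qed

lemma poly_section: "poly (map_poly (\<lambda>p. poly p x) F) y = eval2 F x y"
  by (induction F) (simp_all add: map_poly_pCons eval2_def)

lemma degree_section_le: "degree (map_poly (\<lambda>p. poly p x) F) \<le> degree F"
  by (intro degree_le) (simp add: coeff_map_poly coeff_eq_0)

lemma coeff_section: "coeff F d = [:a:] \<Longrightarrow> coeff (map_poly (\<lambda>p. poly p x) F) d = a"
  by (simp add: coeff_map_poly)

lemma degree_det_le:
  fixes M :: "'a::comm_ring_1 poly mat"
  assumes M: "M \<in> carrier_mat n n"
    and deg: "\<And>i j. i < n \<Longrightarrow> j < n \<Longrightarrow> degree (M $$ (i, j)) \<le> f i"
  shows "degree (det M) \<le> (\<Sum>i<n. f i)"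
proof -
  have "degree (signof p * (\<Prod>i = 0..<n. M $$ (i, p i))) \<le> (\<Sum>i<n. f i)"
    if p: "p permutes {0..<n}" for p
  proof -
    have "degree (signof p * (\<Prod>i = 0..<n. M $$ (i, p i))) \<le> degree (\<Prod>i = 0..<n. M $$ (i, p i))"
      by (cases "sign p = 1") (auto simp: sign_def)
    also have "\<dots> \<le> (\<Sum>i = 0..<n. degree (M $$ (i, p i)))"
      using degree_prod_sum_le[of "{0..<n}" "\<lambda>i. M $$ (i, p i)"] by (simp add: o_def)
    also have "\<dots> \<le> (\<Sum>i = 0..<n. f i)"
      using p by (intro sum_mono deg) (auto simp: permutes_in_image)
    finally show ?thesis by (simp add: atLeast0LessThan)
  qed
  then show ?thesis
    using M by (auto simp: det_def intro!: degree_sum_le finite_permutations)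
qed

text \<open>The Sylvester determinant of \<open>F\<close> and \<open>G\<close> is a polynomial in \<open>X\<close> that vanishes at the
  abscissae of the common zeros; it is nonzero because a linear relation between its rows is an
  identity \<open>A * F + B * G = 0\<close> with \<open>degree B < degree F\<close>.\<close>

lemma card_common_zeros_le:
  fixes F G :: "'a::idom poly poly"
  assumes F: "prime_elem F" "degree F = d" "coeff F d = [:a:]" "d \<ge> 1"
    and degF: "\<And>j. degree (coeff F j) \<le> k"
    and G: "\<not> F dvd G" "degree G < e" and degG: "\<And>j. degree (coeff G j) \<le> l"
  shows "finite {(x, y). eval2 F x y = 0 \<and> eval2 G x y = 0}"
    and "card {(x, y). eval2 F x y = 0 \<and> eval2 G x y = 0} \<le> d * (e * k + d * l)"
proof -
  define N where "N = d + e"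
  \<comment> \<open>The rows are \<open>e\<close> shifts of \<open>F\<close> followed by
    \<open>d\<close> shifts of \<open>G\<close>. Since \<open>e\<close> only bounds the degree of
    \<open>G\<close> strictly, the matrix may be larger than the classical one.\<close>
  define r where "r i = (if i < e then monom 1 i * F else monom 1 (i - e) * G)" for i
  define M where "M = mat N N (\<lambda>(i, j). coeff (r i) j)"
  have M: "M \<in> carrier_mat N N" by (simp add: M_def)
  have [simp]: "F \<noteq> 0" using F(2,4) by auto
  have [simp]: "G \<noteq> 0" using G(1) by auto
  have degr: "degree (r i) < N" if "i < N" for i
    using that F(2) G(2) by (auto simp: r_def N_def degree_mult_eq degree_monom_eq)
  have a: "a \<noteq> 0" using F(2-4) by (metis \<open>F \<noteq> 0\<close> leading_coeff_0_iff pCons_eq_0_iff)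
  have det: "det M \<noteq> 0"
  proof
    assume "det M = 0"
    then have "det (transpose_mat M) = 0" using det_transpose[OF M] by simp
    moreover have Mt: "transpose_mat M \<in> carrier_mat N N" using M by simp
    ultimately obtain v where v: "v \<in> carrier_vec N" "v \<noteq> 0\<^sub>v N" "transpose_mat M *\<^sub>v v = 0\<^sub>v N"
      using det_0_iff_vec_prod_zero[OF Mt] by blast
    define A where "A = (\<Sum>i<e. monom (v $ i) i)"
    define B where "B = (\<Sum>i<d. monom (v $ (e + i)) i)"
    have sum0: "(\<Sum>i<N. smult (v $ i) (r i)) = 0"
    proof (rule poly_eqI)
      fix j
      show "coeff (\<Sum>i<N. smult (v $ i) (r i)) j = coeff 0 j"
      proof (cases "j < N")
        case True
        have "(transpose_mat M *\<^sub>v v) $ j = 0" using v True by simp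
        moreover have "(transpose_mat M *\<^sub>v v) $ j = (\<Sum>i<N. coeff (r i) j * v $ i)"
          using True M v(1)
          by (simp add: scalar_prod_def M_def atLeast0LessThan)
        ultimately show ?thesis by (simp add: coeff_sum mult.commute)
      next
        case False
        then have "coeff (r i) j = 0" if "i < N" for i
          using degr[OF that] by (intro coeff_eq_0) simp
        then show ?thesis by (simp add: coeff_sum)
      qed
    qed
    have "(\<Sum>i<N. smult (v $ i) (r i)) = (\<Sum>i<e. smult (v $ i) (r i)) + (\<Sum>i<d. smult (v $ (e + i)) (r (e + i)))"
      unfolding N_def by (subst add.commute) (rule sum_lessThan_plus)
    also have "\<dots> = A * F + B * G"
      unfolding A_def B_def sum_distrib_right
      by (intro arg_cong2[where f = "(+)"] sum.cong refl) (simp_all add: r_def smult_monom flip: mult_smult_left)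
    finally have AB: "A * F + B * G = 0" using sum0 by simp
    then have "B * G = F * (- A)" by (simp add: eq_neg_iff_add_eq_0 algebra_simps)
    then have "F dvd B * G" by (rule dvdI)
    then have "F dvd B" using F(1) G(1) by (simp add: prime_elem_dvd_mult_iff)
    moreover have "degree B < d" unfolding B_def
      using F(4) by (intro degree_lessI) (auto simp: coeff_sum intro!: sum.neutral)
    ultimately have B: "B = 0" using F(2) dvd_imp_degree_le[of F B] by fastforce
    then have A: "A = 0" using AB by simp
    have "v $ i = 0" if "i < N" for i
    proof (cases "i < e")
      case True
      then have "coeff A i = v $ i" by (simp add: A_def coeff_sum)
      with A show ?thesis by simp
    next
      case False
      then have "coeff B (i - e) = v $ i" using that by (simp add: B_def coeff_sum N_def less_diff_conv2)
      with B show ?thesis by simp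
    qed
    then have "v = 0\<^sub>v N" using v(1) by (intro eq_vecI) auto
    with v(2) show False by simp
  qed
  have "degree (det M) \<le> (\<Sum>i<N. if i < e then k else l)"
  proof (rule degree_det_le[OF M])
    fix i j assume "i < N" "j < N"
    then show "degree (M $$ (i, j)) \<le> (if i < e then k else l)"
      using degF degG by (auto simp: M_def r_def coeff_monom_mult)
  qed
  also have "\<dots> = e * k + d * l"
  proof -
    have "(\<Sum>i<N. if i < e then k else l) = (\<Sum>i<e. if i < e then k else l) + (\<Sum>i<d. if e + i < e then k else l)"
      unfolding N_def by (subst add.commute) (rule sum_lessThan_plus)
    then show ?thesis by simp
  qed
  finally have degdet: "degree (det M) \<le> e * k + d * l" .
  define R where "R = {x. poly (det M) x = 0}"
  have R: "finite R" "card R \<le> e * k + d * l"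
    using det poly_roots_finite[of "det M"] card_poly_roots_bound[of "det M"] degdet
    by (auto simp: R_def)
  have inR: "x \<in> R" if "eval2 F x y = 0" "eval2 G x y = 0" for x y
  proof -
    interpret h: comm_ring_hom "\<lambda>p. poly p x" by unfold_locales auto
    \<comment> \<open>The powers of \<open>y\<close> form a kernel vector of the matrix specialised
      at \<open>x\<close>: row \<open>i\<close> times \<open>w\<close> is \<open>r i\<close>
      evaluated at \<open>(x, y)\<close>.\<close>
    define w where "w = vec N (\<lambda>j. y ^ j)"
    define Mx where "Mx = map_mat (\<lambda>p. poly p x) M"
    have Mx: "Mx \<in> carrier_mat N N" using M by (simp add: Mx_def)
    have "w \<in> carrier_vec N" by (simp add: w_def)
    moreover have "w \<noteq> 0\<^sub>v N"
    proof
      assume "w = 0\<^sub>v N"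
      then have "w $ 0 = 0\<^sub>v N $ 0" by simp
      then show False using F(4) by (simp add: w_def N_def)
    qed
    moreover have "Mx *\<^sub>v w = 0\<^sub>v N"
    proof (rule eq_vecI)
      fix i assume "i < dim_vec (0\<^sub>v N)"
      then have i: "i < N" by simp
      have "(Mx *\<^sub>v w) $ i = (\<Sum>j<N. poly (coeff (r i) j) x * y ^ j)"
        using i by (simp add: Mx_def M_def w_def scalar_prod_def atLeast0LessThan)
      also have "\<dots> = eval2 (r i) x y" using eval2_eq_sum[OF degr[OF i]] by simp
      also have "\<dots> = 0" using that by (simp add: r_def eval2_def)
      finally show "(Mx *\<^sub>v w) $ i = 0\<^sub>v N $ i" using i by simp
    qed (use Mx in auto)
    ultimately have "det Mx = 0" using det_0_iff_vec_prod_zero[OF Mx] by blast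
    then show ?thesis by (simp add: R_def Mx_def)
  qed
  \<comment> \<open>The coefficient at \<open>Y ^ d\<close> is free of \<open>X\<close>, so no fibre
    degenerates and each abscissa carries at most \<open>d\<close> ordinates.\<close>
  define f where "f x = map_poly (\<lambda>p. poly p x) F" for x
  have f: "f x \<noteq> 0" "degree (f x) \<le> d" for x
  proof -
    have "coeff (f x) d = a" unfolding f_def using F(3) by (rule coeff_section)
    then show "f x \<noteq> 0" using a by auto
    show "degree (f x) \<le> d" using degree_section_le[of x F] F(2) by (simp add: f_def)
  qed
  have eval_f: "eval2 F x y = poly (f x) y" for x y
    by (simp add: f_def poly_section)
  let ?Z = "{(x, y). eval2 F x y = 0 \<and> eval2 G x y = 0}"
  have sub: "?Z \<subseteq> (SIGMA x:R. {y. poly (f x) y = 0})"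
    using inR eval_f by auto
  have fin: "finite (SIGMA x:R. {y. poly (f x) y = 0})"
    using R(1) f(1) by (intro finite_SigmaI poly_roots_finite) auto
  then show "finite ?Z" using sub finite_subset by blast
  have "card ?Z \<le> card (SIGMA x:R. {y. poly (f x) y = 0})"
    by (rule card_mono[OF fin sub])
  also have "\<dots> = (\<Sum>x\<in>R. card {y. poly (f x) y = 0})"
    using R(1) f(1) by (intro card_SigmaI) (auto intro: poly_roots_finite)
  also have "\<dots> \<le> (\<Sum>x\<in>R. d)"
    by (intro sum_mono order_trans[OF card_poly_roots_bound[OF f(1)] f(2)])
  also have "\<dots> \<le> (e * k + d * l) * d" using R(2) by simp
  finally show "card ?Z \<le> d * (e * k + d * l)" by (simp add: mult.commute)
qed

section \<open>Shears\<close>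

lemma eval2_0 [simp]: "eval2 0 x y = 0"
  and eval2_1 [simp]: "eval2 1 x y = 1"
  and eval2_add [simp]: "eval2 (F + G) x y = eval2 F x y + eval2 G x y"
  and eval2_diff [simp]: "eval2 (F - G) x y = eval2 F x y - eval2 G x y"
  and eval2_mult [simp]: "eval2 (F * G) x y = eval2 F x y * eval2 G x y"
  and eval2_smult [simp]: "eval2 (smult p F) x y = poly p x * eval2 F x y"
  and eval2_pCons [simp]: "eval2 (pCons p F) x y = poly p x + y * eval2 F x y"
  by (simp_all add: eval2_def)

text \<open>Allows identities between sheared polynomials to be checked on values; this works
  because F_q[T] is infinite although F_q is not.\<close>

lemma eval2_eqI:
  fixes F G :: "'a::idom poly poly"
  assumes inf: "infinite (UNIV :: 'a set)" and eq: "\<And>x y. eval2 F x y = eval2 G x y"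
  shows "F = G"
proof (rule ccontr)
  assume "F \<noteq> G"
  then have fin: "finite {q. poly (F - G) q = 0}" by (intro poly_roots_finite) simp
  have "poly (F - G) [:y:] = 0" for y
  proof (rule ccontr)
    assume "poly (F - G) [:y:] \<noteq> 0"
    then have "finite {x. poly (poly (F - G) [:y:]) x = 0}" by (rule poly_roots_finite)
    moreover have "{x. poly (poly (F - G) [:y:]) x = 0} = UNIV"
      using eq by (auto simp: eval2_def)
    ultimately show False using inf by simp
  qed
  then have "range (\<lambda>y. [:y:]) \<subseteq> {q. poly (F - G) q = 0}" by blast
  then have "finite (range (\<lambda>y :: 'a. [:y:]))" using fin finite_subset by blast
  then show False using inf by (auto dest!: finite_imageD simp: inj_on_def)
qed

lemma infinite_UNIV_poly: "infinite (UNIV :: 'a::zero_neq_one poly set)"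
proof
  assume "finite (UNIV :: 'a poly set)"
  then have "finite (range (\<lambda>n. monom (1 :: 'a) n))" by (rule rev_finite_subset) simp
  moreover have "inj (\<lambda>n. monom (1 :: 'a) n)"
    by (rule injI) (metis degree_monom_eq zero_neq_one)
  ultimately show False using finite_imageD infinite_UNIV_nat by blast
qed

text \<open>This is \<open>p(X + l Y)\<close>: the coefficients of \<open>p\<close> become
  constants, and \<open>[:[:0, 1:], [:l:]:]\<close> is \<open>X + l Y\<close>.\<close>

definition subst_shear :: "'a::comm_ring_1 \<Rightarrow> 'a poly \<Rightarrow> 'a poly poly" where
  "subst_shear l p = poly (map_poly (\<lambda>c. [:[:c:]:]) p) [:[:0, 1:], [:l:]:]"

text \<open>\<open>shear l F\<close> is \<open>F(X + l Y, Y)\<close>.\<close>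

definition shear :: "'a::comm_ring_1 \<Rightarrow> 'a poly poly \<Rightarrow> 'a poly poly" where
  "shear l F = poly (map_poly (subst_shear l) F) [:0, 1:]"

lemma subst_shear_0 [simp]: "subst_shear l 0 = 0"
  and subst_shear_pCons [simp]:
    "subst_shear l (pCons c p) = [:[:c:]:] + [:[:0, 1:], [:l:]:] * subst_shear l p"
  by (simp_all add: subst_shear_def map_poly_pCons)

lemma shear_0 [simp]: "shear l 0 = 0"
  and shear_pCons [simp]: "shear l (pCons p F) = subst_shear l p + pCons 0 (shear l F)"
  by (simp_all add: shear_def map_poly_pCons)

lemma eval2_subst_shear: "eval2 (subst_shear l p) x y = poly p (x + l * y)"
  by (induction p) (simp_all add: algebra_simps)

lemma eval2_shear: "eval2 (shear l F) x y = eval2 F (x + l * y) y"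
  by (induction F) (simp_all add: eval2_subst_shear)

context
  fixes l :: "'k::field poly"
begin

lemma shear_add: "shear l (F + G) = shear l F + shear l G"
  by (rule eval2_eqI[OF infinite_UNIV_poly]) (simp add: eval2_shear)

lemma shear_mult: "shear l (F * G) = shear l F * shear l G"
  by (rule eval2_eqI[OF infinite_UNIV_poly]) (simp add: eval2_shear)

lemma shear_smult_const: "shear l (smult [:c:] F) = smult [:c:] (shear l F)"
  by (rule eval2_eqI[OF infinite_UNIV_poly]) (simp add: eval2_shear)

lemma shear_one: "shear l 1 = 1"
  by (rule eval2_eqI[OF infinite_UNIV_poly]) (simp add: eval2_shear)

lemma shear_shear_uminus: "shear (- l) (shear l F) = F" "shear l (shear (- l) F) = F"
  by (rule eval2_eqI[OF infinite_UNIV_poly]; simp add: eval2_shear)+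

lemma shear_dvd_iff: "shear l F dvd shear l G \<longleftrightarrow> F dvd G"
  by (metis dvdE dvdI shear_mult shear_shear_uminus)

lemma shear_eq_0_iff: "shear l F = 0 \<longleftrightarrow> F = 0"
  by (metis shear_shear_uminus(1) shear_0)

lemma prime_elem_shear:
  assumes "prime_elem F"
  shows "prime_elem (shear l F)"
proof (rule prime_elemI)
  show "shear l F \<noteq> 0" using assms by (simp add: shear_eq_0_iff)
  show "\<not> is_unit (shear l F)"
    using assms shear_dvd_iff[of F 1] by (auto simp: shear_one)
next
  fix A B assume "shear l F dvd A * B"
  then have "F dvd shear (- l) A * shear (- l) B"
    using shear_dvd_iff[of F "shear (- l) A * shear (- l) B"]
    by (simp add: shear_mult shear_shear_uminus)
  then have "F dvd shear (- l) A \<or> F dvd shear (- l) B"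
    using assms by (simp add: prime_elem_dvd_mult_iff)
  then show "shear l F dvd A \<or> shear l F dvd B"
    by (metis shear_dvd_iff shear_shear_uminus(2))
qed

lemma subst_shear_add: "subst_shear l (p + q) = subst_shear l p + subst_shear l q"
  by (rule eval2_eqI[OF infinite_UNIV_poly]) (simp add: eval2_subst_shear)

lemma pderiv_subst_shear: "pderiv (subst_shear l p) = smult [:l:] (subst_shear l (pderiv p))"
proof (induction p)
  case (pCons c p)
  then show ?case
    by (simp add: pderiv_add pderiv_smult pderiv_pCons subst_shear_add smult_add_right)
qed simp

text \<open>The chain rule, where \<open>map_poly pderiv F\<close> is the partial derivative in
  \<open>X\<close>. It lets a suitable \<open>l\<close> produce a nonzero
  \<open>Y\<close>-derivative whenever one of the two partial derivatives of \<open>F\<close> is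
  nonzero.\<close>

lemma pderiv_shear:
  "pderiv (shear l F) = smult [:l:] (shear l (map_poly pderiv F)) + shear l (pderiv F)"
proof (induction F)
  case (pCons p F)
  then show ?case
    by (simp add: pderiv_add pderiv_pCons pderiv_subst_shear map_poly_pCons shear_add smult_add_right)
qed simp

end

section \<open>Total degree and its behaviour under shears\<close>

definition tdeg_le :: "'a::zero poly poly \<Rightarrow> nat \<Rightarrow> bool" where
  "tdeg_le F d \<longleftrightarrow> (\<forall>i j. d < i + j \<longrightarrow> coeff (coeff F j) i = 0)"

lemma tdeg_le_iff: "tdeg_le F d \<longleftrightarrow> total_degree2 F \<le> d"
proof -
  let ?A = "{i + j | i j. coeff (coeff F j) i \<noteq> 0}"
  have "total_degree2 F \<le> d \<longleftrightarrow> (\<forall>m\<in>?A. m \<le> d)"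
    unfolding total_degree2_def using finite_total_degree2_set[of F] by (subst Max_le_iff) auto
  also have "\<dots> \<longleftrightarrow> tdeg_le F d"
    unfolding tdeg_le_def using not_le by blast
  finally show ?thesis ..
qed

lemma total_degree2_attained:
  assumes "total_degree2 F = d" "d \<ge> 1"
  obtains j where "j \<le> d" "coeff (coeff F j) (d - j) \<noteq> 0"
proof -
  let ?A = "{i + j | i j. coeff (coeff F j) i \<noteq> 0}"
  have "d \<in> insert 0 ?A"
    using Max_in[of "insert 0 ?A"] finite_total_degree2_set[of F] assms(1)
    unfolding total_degree2_def by auto
  then obtain i j where "d = i + j" "coeff (coeff F j) i \<noteq> 0" using assms(2) by auto
  then show ?thesis using that[of j] by simp
qed

lemma tdeg_leD_degree:
  assumes "tdeg_le F d"
  shows "degree F \<le> d" "degree (coeff F j) \<le> d - j" "j \<le> d \<or> coeff F j = 0"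
proof -
  have 0: "coeff F j = 0" if "d < j" for j
    using assms that by (auto simp: tdeg_le_def poly_eq_iff)
  then show "degree F \<le> d" by (intro degree_le) auto
  show "j \<le> d \<or> coeff F j = 0" using 0 by (cases "j \<le> d") auto
  show "degree (coeff F j) \<le> d - j"
    using assms by (intro degree_le) (auto simp: tdeg_le_def)
qed

lemma tdeg_le_add: "tdeg_le F d \<Longrightarrow> tdeg_le G d \<Longrightarrow> tdeg_le (F + G :: 'a::comm_monoid_add poly poly) d"
  by (simp add: tdeg_le_def)

lemma tdeg_le_subst_shear: "degree p \<le> d \<Longrightarrow> tdeg_le (subst_shear l p) d"
proof (induction p arbitrary: d)
  case (pCons c p)
  show ?case
  proof (cases "p = 0")
    case True
    then show ?thesis by (auto simp: tdeg_le_def coeff_pCons split: nat.split)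
  next
    case False
    then obtain e where d: "d = Suc e" using pCons.prems by (cases d) auto
    with False pCons have IH: "tdeg_le (subst_shear l p) e" by auto
    then show ?thesis unfolding d
      by (auto simp: tdeg_le_def coeff_pCons split: nat.split)
  qed
qed (simp add: tdeg_le_def)

lemma tdeg_le_shear: "tdeg_le F d \<Longrightarrow> tdeg_le (shear l F) d"
proof (induction F arbitrary: d)
  case (pCons p F)
  have "degree p \<le> d" using tdeg_leD_degree(2)[OF pCons.prems, of 0] by simp
  then have 1: "tdeg_le (subst_shear l p) d" by (rule tdeg_le_subst_shear)
  have "tdeg_le (pCons 0 (shear l F)) d"
  proof (cases "F = 0")
    case False
    then obtain e where d: "d = Suc e"
      using tdeg_leD_degree(1)[OF pCons.prems] by (cases d) auto
    have "tdeg_le F e"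
      unfolding tdeg_le_def
    proof (intro allI impI)
      fix i j assume "e < i + j"
      then show "coeff (coeff F j) i = 0"
        using pCons.prems[unfolded tdeg_le_def d, rule_format, of i "Suc j"] by simp
    qed
    from pCons.IH[OF this] show ?thesis unfolding d
      by (auto simp: tdeg_le_def coeff_pCons split: nat.split)
  qed (simp add: tdeg_le_def)
  with 1 show ?case by (simp add: tdeg_le_add)
qed (simp add: tdeg_le_def)

lemma coeff_subst_shear: "coeff (coeff (subst_shear l p) k) 0 = coeff p k * l ^ k"
  by (induction p arbitrary: k) (simp_all add: coeff_pCons split: nat.split)

text \<open>The value at \<open>(l, 1)\<close> of the homogeneous part of degree \<open>k\<close>.\<close>

lemma coeff_shear: "coeff (coeff (shear l F) k) 0 = (\<Sum>j\<le>k. coeff (coeff F j) (k - j) * l ^ (k - j))"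
proof (induction F arbitrary: k)
  case (pCons p F)
  then show ?case
    by (cases k) (simp_all add: coeff_subst_shear sum.atMost_Suc_shift del: sum.atMost_Suc)
qed simp

section \<open>Boxes and heights\<close>

text \<open>Unlike \<open>poly_box h\<close>, the set \<open>low_degree h\<close> has exactly \<open>q ^ h\<close> elements also for \<open>h = 0\<close>.\<close>

definition low_degree :: "nat \<Rightarrow> 'a::zero poly set" where
  "low_degree h = {p. \<forall>i\<ge>h. coeff p i = 0}"

lemma low_degree_0: "low_degree 0 = {0}"
  by (auto simp: low_degree_def poly_eq_iff)

lemma low_degree_Suc: "low_degree (Suc n) = poly_box n"
  by (auto simp: low_degree_def poly_box_def Suc_le_eq coeff_eq_0 intro: degree_le)

lemma low_degree_iff: "p \<in> low_degree h \<longleftrightarrow> p = 0 \<or> degree p < h"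
  by (auto simp: low_degree_def coeff_eq_0 not_less dest: leading_coeff_neq_0)

lemma card_low_degree: "card (low_degree h :: 'a::{zero,finite} poly set) = CARD('a) ^ h"
  by (cases h) (simp_all add: low_degree_0 low_degree_Suc card_poly_box)

lemma finite_low_degree [simp]: "finite (low_degree h :: 'a::{zero,finite} poly set)"
  by (cases h) (simp_all add: low_degree_0 low_degree_Suc finite_poly_box)

lemma low_degree_diff:
  "p \<in> low_degree h \<Longrightarrow> q \<in> low_degree h \<Longrightarrow> p - q \<in> low_degree (h :: nat)"
  for p q :: "'a::ab_group_add poly"
  by (simp add: low_degree_def)

lemma mod_in_low_degree: "p mod q \<in> low_degree (degree q)" if "q \<noteq> 0" for p q :: "'a::field poly"
  using degree_mod_less[OF that] by (auto simp: low_degree_iff)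

lemma one_less_card_field: "1 < CARD('a::{zero_neq_one,finite})"
proof -
  have "card {0, 1 :: 'a} \<le> CARD('a)" by (intro card_mono) auto
  then show ?thesis by simp
qed

lemma card_PiE_low_degree:
  assumes "finite I"
  shows "card (PiE I (\<lambda>i. low_degree (h i) :: 'a::{zero,finite} poly set)) = CARD('a) ^ (\<Sum>i\<in>I. h i)"
  using assms by (simp add: card_PiE card_low_degree power_sum)

text \<open>Siegel's lemma by counting: \<open>h\<close> and \<open>k\<close> measure lengths in
  coefficients from F_q, so there are more arguments than possible values. The maps to which it is
  applied are linear, which turns a collision into the nonzero solution
  \<open>c - c'\<close>.\<close>

lemma low_degree_pigeonhole:
  fixes f :: "('i \<Rightarrow> 'a::{field,finite} poly) \<Rightarrow> 'j \<Rightarrow> 'a poly"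
  assumes I: "finite I" and J: "finite J"
    and f: "\<And>c j. c \<in> PiE I (\<lambda>i. low_degree (h i)) \<Longrightarrow> j \<in> J \<Longrightarrow> f c j \<in> low_degree (k j)"
    and less: "(\<Sum>j\<in>J. k j) < (\<Sum>i\<in>I. h i)"
  obtains c c' where "c \<in> PiE I (\<lambda>i. low_degree (h i))" "c' \<in> PiE I (\<lambda>i. low_degree (h i))"
    "c \<noteq> c'" "\<And>j. j \<in> J \<Longrightarrow> f c j = f c' j"
proof -
  let ?C = "PiE I (\<lambda>i. low_degree (h i) :: 'a poly set)"
  let ?R = "PiE J (\<lambda>j. low_degree (k j) :: 'a poly set)"
  let ?g = "\<lambda>c. restrict (f c) J"
  have "card (?g ` ?C) \<le> card ?R"
    using f J by (intro card_mono finite_PiE) auto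
  also have "\<dots> < card ?C"
    using less I J one_less_card_field[where 'a = 'a] by (simp add: card_PiE_low_degree)
  finally have "\<not> inj_on ?g ?C" by (rule pigeonhole)
  then obtain c c' where *: "c \<in> ?C" "c' \<in> ?C" "c \<noteq> c'" "?g c = ?g c'"
    by (auto simp: inj_on_def)
  show ?thesis
  proof (rule that[OF *(1-3)])
    fix j assume "j \<in> J"
    then show "f c j = f c' j" using fun_cong[OF *(4), of j] by simp
  qed
qed

text \<open>A degree-like function on a ring: minus a nonarchimedean valuation.\<close>

definition nonarch :: "('a::idom \<Rightarrow> nat) \<Rightarrow> bool" where
  "nonarch v \<longleftrightarrow> v 0 = 0 \<and> (\<forall>a b. v (a - b) \<le> max (v a) (v b)) \<and>
     (\<forall>a b. a \<noteq> 0 \<longrightarrow> b \<noteq> 0 \<longrightarrow> v (a * b) = v a + v b)"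

text \<open>The Gauss norm, written additively. Two applications to \<open>degree\<close> give the
  largest degree in \<open>T\<close> among the coefficients of a bivariate polynomial.\<close>

definition coeff_height :: "('a::zero \<Rightarrow> nat) \<Rightarrow> 'a poly \<Rightarrow> nat" where
  "coeff_height v f = Max ((\<lambda>i. v (coeff f i)) ` {..degree f})"

lemma nonarch_degree: "nonarch (degree :: 'a::idom poly \<Rightarrow> nat)"
  by (simp add: nonarch_def degree_diff_le_max degree_mult_eq)

lemma coeff_height_0 [simp]: "v 0 = 0 \<Longrightarrow> coeff_height v 0 = 0"
  by (simp add: coeff_height_def)

lemma coeff_le_coeff_height: "v 0 = 0 \<Longrightarrow> v (coeff f i) \<le> coeff_height v f"
  by (cases "i \<le> degree f") (auto simp: coeff_height_def coeff_eq_0)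

lemma coeff_height_le: "(\<And>i. v (coeff f i) \<le> h) \<Longrightarrow> coeff_height v f \<le> h"
  by (auto simp: coeff_height_def)

text \<open>The least index of maximal valuation is the one that isolates a dominant term in a
  product. Because \<open>v 0 = 0\<close>, a zero coefficient may also attain height 0, so a nonzero
  one has to be selected.\<close>

lemma coeff_height_attained:
  assumes "v 0 = 0" "f \<noteq> 0"
  obtains i where "coeff f i \<noteq> 0" "v (coeff f i) = coeff_height v f"
    "\<And>k. k < i \<Longrightarrow> coeff f k = 0 \<or> v (coeff f k) < coeff_height v f"
proof -
  have "coeff_height v f \<in> (\<lambda>i. v (coeff f i)) ` {..degree f}"
    unfolding coeff_height_def by (intro Max_in) auto
  then obtain j where j: "v (coeff f j) = coeff_height v f" by auto
  let ?P = "\<lambda>i. coeff f i \<noteq> 0 \<and> v (coeff f i) = coeff_height v f"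
  have ex: "\<exists>i. ?P i"
  proof (cases "coeff f j = 0")
    case True
    then have "coeff_height v f = 0" using j assms by simp
    then show ?thesis
      using assms coeff_le_coeff_height[of v f "degree f"] by (intro exI[of _ "degree f"]) auto
  qed (use j in auto)
  let ?i = "LEAST i. ?P i"
  have "?P ?i" using ex by (rule LeastI_ex)
  moreover have "coeff f k = 0 \<or> v (coeff f k) < coeff_height v f" if "k < ?i" for k
    using not_less_Least[OF that] coeff_le_coeff_height[of v f k] assms(1) by (auto simp: less_le)
  ultimately show ?thesis using that by blast
qed

text \<open>The alternative \<open>f i = 0\<close> is present because the convention
  \<open>v 0 = 0\<close> would not make zero terms smaller than \<open>h = 0\<close>.\<close>

lemma nonarch_sum:
  assumes "nonarch v" "\<And>i. i \<in> A \<Longrightarrow> f i = 0 \<or> v (f i) < h"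
  shows "sum f A = 0 \<or> v (sum f A) < h"
  using assms(2)
proof (induction A rule: infinite_finite_induct)
  case (insert x A)
  have v: "v (a - b) \<le> max (v a) (v b)" for a b using assms(1) by (simp add: nonarch_def)
  have neg: "v (- a) \<le> v a" for a using v[of 0 a] assms(1) by (simp add: nonarch_def)
  have "v (f x + sum f A) \<le> max (v (f x)) (v (sum f A))"
    using v[of "f x" "- sum f A"] neg[of "sum f A"] by simp
  moreover have "f x = 0 \<or> v (f x) < h" "sum f A = 0 \<or> v (sum f A) < h"
    using insert by auto
  ultimately show ?case using insert.hyps by auto
qed auto

text \<open>Gauss's lemma. If \<open>i\<close> and \<open>j\<close> are the least indices of maximal
  valuation in the two factors, then in the coefficient \<open>i + j\<close> of the product one term
  strictly dominates all the others and cannot be cancelled.\<close>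

lemma nonarch_coeff_height:
  assumes "nonarch v"
  shows "nonarch (coeff_height v)"
proof -
  have v0: "v 0 = 0" and vd: "v (a - b) \<le> max (v a) (v b)"
    and vm: "a \<noteq> 0 \<Longrightarrow> b \<noteq> 0 \<Longrightarrow> v (a * b) = v a + v b" for a b
    using assms by (auto simp: nonarch_def)
  let ?H = "coeff_height v"
  have "?H (f * g) = ?H f + ?H g" if fg: "f \<noteq> 0" "g \<noteq> 0" for f g
  proof (rule antisym)
    show "?H (f * g) \<le> ?H f + ?H g"
    proof (rule coeff_height_le)
      fix n
      have "(\<Sum>i\<le>n. coeff f i * coeff g (n - i)) = 0 \<or>
          v (\<Sum>i\<le>n. coeff f i * coeff g (n - i)) < Suc (?H f + ?H g)"
      proof (rule nonarch_sum[OF assms])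
        fix i
        have "v (coeff f i) \<le> ?H f" "v (coeff g (n - i)) \<le> ?H g"
          using v0 by (simp_all add: coeff_le_coeff_height)
        then show "coeff f i * coeff g (n - i) = 0 \<or>
            v (coeff f i * coeff g (n - i)) < Suc (?H f + ?H g)"
          using vm[of "coeff f i" "coeff g (n - i)"]
          by (cases "coeff f i = 0 \<or> coeff g (n - i) = 0") auto
      qed
      then show "v (coeff (f * g) n) \<le> ?H f + ?H g"
        using v0 by (auto simp: coeff_mult)
    qed
    obtain i where i: "coeff f i \<noteq> 0" "v (coeff f i) = ?H f"
      "\<And>k. k < i \<Longrightarrow> coeff f k = 0 \<or> v (coeff f k) < ?H f"
      using coeff_height_attained[where v = v, OF v0 fg(1)] by metis
    obtain j where j: "coeff g j \<noteq> 0" "v (coeff g j) = ?H g"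
      "\<And>k. k < j \<Longrightarrow> coeff g k = 0 \<or> v (coeff g k) < ?H g"
      using coeff_height_attained[where v = v, OF v0 fg(2)] by metis
    define others where "others = (\<Sum>k\<in>{..i+j} - {i}. coeff f k * coeff g (i + j - k))"
    have "others = 0 \<or> v others < ?H f + ?H g"
      unfolding others_def
    proof (rule nonarch_sum[OF assms])
      fix k assume k: "k \<in> {..i+j} - {i}"
      let ?a = "coeff f k" and ?b = "coeff g (i + j - k)"
      have le: "v ?a \<le> ?H f" "v ?b \<le> ?H g"
        using v0 by (simp_all add: coeff_le_coeff_height)
      have "k < i \<or> i + j - k < j" using k by auto
      then have "?a = 0 \<or> ?b = 0 \<or> v ?a < ?H f \<or> v ?b < ?H g"
        using i(3) j(3) by blast
      then show "?a * ?b = 0 \<or> v (?a * ?b) < ?H f + ?H g"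
        using vm[of ?a ?b] le by (cases "?a = 0 \<or> ?b = 0") auto
    qed
    moreover have "coeff (f * g) (i + j) = coeff f i * coeff g j + others"
      unfolding coeff_mult others_def by (subst sum.remove[of _ i]) auto
    moreover have "v (coeff f i * coeff g j) = ?H f + ?H g" using vm i j by simp
    moreover have "v (coeff f i * coeff g j) \<le> max (v (coeff f i * coeff g j + others)) (v others)"
      using vd[of "coeff f i * coeff g j + others" others] by simp
    ultimately have "?H f + ?H g \<le> v (coeff (f * g) (i + j))"
      using v0 by (auto simp: max_def split: if_splits)
    also have "\<dots> \<le> ?H (f * g)" using v0 by (rule coeff_le_coeff_height)
    finally show "?H f + ?H g \<le> ?H (f * g)" .
  qed
  moreover have "?H (f - g) \<le> max (?H f) (?H g)" for f g
  proof (rule coeff_height_le)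
    fix i
    show "v (coeff (f - g) i) \<le> max (?H f) (?H g)"
      using vd[of "coeff f i" "coeff g i"] coeff_le_coeff_height[of v f i]
        coeff_le_coeff_height[of v g i] v0 by auto
  qed
  ultimately show ?thesis using v0 by (simp add: nonarch_def coeff_height_def)
qed

lemma nonarch_dvd_le:
  assumes "nonarch v" "a dvd b" "b \<noteq> 0"
  shows "v a \<le> v b"
  using assms by (auto simp: nonarch_def)

abbreviation height :: "'a::idom poly poly poly \<Rightarrow> nat" where
  "height \<equiv> coeff_height (coeff_height degree)"

lemma nonarch_height: "nonarch height"
  by (intro nonarch_coeff_height nonarch_degree)

lemma degree_coeff_le_height: "degree (coeff (coeff F j) i) \<le> height F"
  using coeff_le_coeff_height[of degree "coeff F j" i]
    coeff_le_coeff_height[of "coeff_height degree" F j]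
  by simp

lemma height_le: "(\<And>i j. degree (coeff (coeff F j) i) \<le> h) \<Longrightarrow> height F \<le> h"
  by (intro coeff_height_le)

section \<open>Inseparable curves\<close>

lemma pderiv_poly:
  "pderiv (poly p x) = poly (map_poly pderiv p) x + pderiv x * poly (pderiv p) x"
  for x :: "'a::idom poly"
  by (induction p) (simp_all add: pderiv_add pderiv_mult pderiv_pCons map_poly_pCons algebra_simps)

text \<open>The chain rule for \<open>F(T, x(T), y(T))\<close>:
  \<open>map_poly (map_poly pderiv)\<close>, \<open>map_poly pderiv\<close> and
  \<open>pderiv\<close> are the partial derivatives in \<open>T\<close>, \<open>X\<close> and
  \<open>Y\<close>.\<close>

lemma pderiv_eval2:
  fixes x y :: "'a::idom poly"
  shows "pderiv (eval2 F x y) = eval2 (map_poly (map_poly pderiv) F) x y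
     + pderiv x * eval2 (map_poly pderiv F) x y + pderiv y * eval2 (pderiv F) x y"
  by (induction F)
    (simp_all add: pderiv_add pderiv_mult pderiv_pCons map_poly_pCons pderiv_poly algebra_simps)

text \<open>If the derivative vanishes, only exponents divisible by the characteristic survive;
  since Frobenius is additive, roots of the coefficients then assemble into a root of
  \<open>f\<close>. It is applied once for each of the variables \<open>T\<close>, \<open>X\<close>,
  \<open>Y\<close>.\<close>

lemma pth_power_poly:
  fixes f :: "'a::idom poly"
  assumes p: "prime CHAR('a)" and f: "pderiv f = 0" and coeffs: "\<And>i. \<exists>b. coeff f i = b ^ CHAR('a)"
  shows "\<exists>g. f = g ^ CHAR('a)"
proof -
  define p where "p = CHAR('a)"
  have p0: "p > 0" using p by (simp add: p_def prime_gt_0_nat)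
  have dvd: "coeff f i = 0 \<or> p dvd i" for i
  proof (cases i)
    case (Suc k)
    have "of_nat i * coeff f i = coeff (pderiv f) k" by (simp add: coeff_pderiv Suc)
    then have "of_nat i * coeff f i = 0" using f by simp
    then show ?thesis by (auto simp: p_def of_nat_eq_0_iff_char_dvd simp del: of_nat_Suc)
  qed simp
  obtain b where b: "\<And>i. coeff f i = b i ^ p" using coeffs unfolding p_def by metis
  define g where "g = (\<Sum>i\<le>degree f. monom (b (p * i)) i)"
  have "g ^ p = (\<Sum>i\<le>degree f. monom (b (p * i)) i ^ p)"
    unfolding g_def p_def using p by (intro freshmans_dream_sum) simp_all
  also have "\<dots> = (\<Sum>i\<le>degree f. monom (coeff f (p * i)) (p * i))"
    by (simp add: monom_power b mult.commute)
  also have "\<dots> = f"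
  proof (rule poly_eqI)
    fix k
    have "coeff (\<Sum>i\<le>degree f. monom (coeff f (p * i)) (p * i)) k
        = (\<Sum>i\<le>degree f. if p * i = k then coeff f k else 0)"
      by (simp add: coeff_sum) (intro sum.cong; auto)
    also have "\<dots> = coeff f k"
    proof (cases "coeff f k = 0")
      case False
      then obtain i where i: "k = p * i" using dvd by blast
      have "k \<le> degree f" using False by (rule le_degree)
      then have "i \<le> degree f" using i p0 by (metis le_trans mult_le_mono1 One_nat_def Suc_leI nat_mult_1)
      then show ?thesis using i p0 by simp
    qed (simp add: sum.neutral)
    finally show "coeff (\<Sum>i\<le>degree f. monom (coeff f (p * i)) (p * i)) k = coeff f k" .
  qed
  finally show ?thesis unfolding p_def by metis
qed

lemma prime_CHAR_finite_field: "prime CHAR('k::{field,finite})"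
  by (intro prime_CHAR_semidom finite_imp_CHAR_pos) simp

lemma pth_power_finite_field: "\<exists>b. (a :: 'k::{field,finite}) = b ^ CHAR('k)"
proof -
  let ?f = "\<lambda>x :: 'k. x ^ CHAR('k)"
  have "inj ?f"
  proof (rule injI)
    fix x y :: 'k assume "x ^ CHAR('k) = y ^ CHAR('k)"
    moreover have "(x - y + y) ^ CHAR('k) = (x - y) ^ CHAR('k) + y ^ CHAR('k)"
      using prime_CHAR_finite_field by (rule freshmans_dream) simp
    ultimately show "x = y" by simp
  qed
  then have "surj ?f" by (simp add: finite_UNIV_inj_surj)
  then show ?thesis by (metis surjD)
qed

lemma pth_power_if_pderivs_0:
  fixes F :: "'k::{field,finite} poly poly poly"
  assumes "pderiv F = 0" "map_poly pderiv F = 0" "map_poly (map_poly pderiv) F = 0"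
  shows "\<exists>G. F = G ^ CHAR('k)"
proof -
  have p: "prime CHAR('k)" by (rule prime_CHAR_finite_field)
  have X: "pderiv (coeff F j) = 0" for j
    using arg_cong[OF assms(2), of "\<lambda>F. coeff F j"] by (simp add: coeff_map_poly)
  have T: "pderiv (coeff (coeff F j) i) = 0" for i j
    using arg_cong[OF assms(3), of "\<lambda>F. coeff (coeff F j) i"] by (simp add: coeff_map_poly)
  have "\<exists>b. coeff (coeff F j) i = b ^ CHAR('k)" for i j
    using pth_power_poly[OF p T] pth_power_finite_field by blast
  then have "\<exists>b. coeff F j = b ^ CHAR('k poly)" for j
    using pth_power_poly[of "coeff F j"] p X by simp
  then show ?thesis
    using pth_power_poly[of F] p assms(1) by simp
qed

lemma not_irreducible_power:
  assumes "n \<ge> 2"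
  shows "\<not> irreducible (a ^ n :: 'a::comm_semiring_1)"
proof
  assume irr: "irreducible (a ^ n)"
  obtain m where n: "n = Suc (Suc m)" using assms by (metis add_2_eq_Suc le_Suc_ex)
  have "a ^ n = a * a ^ Suc m" by (simp add: n)
  then have "a dvd 1 \<or> a ^ Suc m dvd 1" using irr by (metis irreducible_def)
  then have "a dvd 1" by (metis dvd_trans dvd_triv_left power_Suc)
  then have "a ^ n dvd 1" by (metis dvd_power_same power_one)
  then show False using irr by (simp add: irreducible_def)
qed

lemma degree_pderiv_le: "degree (pderiv p) \<le> degree p - 1"
  by (intro degree_le) (auto simp: coeff_pderiv coeff_eq_0)

lemma pderiv_degree_0: "degree p = 0 \<Longrightarrow> pderiv p = 0"
  by (auto elim!: degree_eq_zeroE simp: pderiv_pCons)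

lemma tdeg_le_map_poly:
  assumes "tdeg_le F d" "f 0 = 0"
  shows "tdeg_le (map_poly (map_poly f) F) d"
  using assms by (simp add: tdeg_le_def coeff_map_poly)

text \<open>If \<open>F\<close> has no partial derivative in \<open>X\<close> and \<open>Y\<close>, differentiating \<open>F(x(T), y(T)) = 0\<close>
  with respect to \<open>T\<close> shows that all points lie on the curve obtained by differentiating the
  coefficients of \<open>F\<close>, which has smaller height.\<close>

lemma inseparable_second_curve:
  fixes F :: "'k::{field,finite} poly poly poly"
  assumes irr: "irreducible F" and deg: "tdeg_le F d"
    and F: "pderiv F = 0" "map_poly pderiv F = 0"
  obtains G where "tdeg_le G d" "\<not> F dvd G" "\<And>x y. eval2 F x y = 0 \<Longrightarrow> eval2 G x y = 0"
proof -
  define G where "G = map_poly (map_poly pderiv) F"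
  have G0: "G \<noteq> 0"
  proof
    assume "G = 0"
    then obtain H where "F = H ^ CHAR('k)" using pth_power_if_pderivs_0[of F] F by (auto simp: G_def)
    moreover have "CHAR('k) \<ge> 2" using prime_CHAR_finite_field[where 'k = 'k] by (rule prime_ge_2_nat)
    ultimately show False using irr not_irreducible_power by metis
  qed
  have "height G < height F"
  proof -
    have *: "degree (coeff (coeff G j) i) \<le> height F - 1" for i j
      using degree_coeff_le_height[of F j i] degree_pderiv_le[of "coeff (coeff F j) i"]
      by (simp add: G_def coeff_map_poly)
    then have "height G \<le> height F - 1" by (rule height_le)
    moreover have "height F \<noteq> 0"
    proof
      assume "height F = 0"
      then have "degree (coeff (coeff F j) i) = 0" for i j using degree_coeff_le_height[of F j i] by simp
      then have "G = 0" by (simp add: G_def poly_eq_iff coeff_map_poly pderiv_degree_0)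
      with G0 show False by simp
    qed
    ultimately show ?thesis by simp
  qed
  \<comment> \<open>Height is additive on products, so a nonzero multiple of \<open>F\<close> has at
    least the height of \<open>F\<close>.\<close>
  then have "\<not> F dvd G" using nonarch_dvd_le[OF nonarch_height _ G0] by fastforce
  moreover have "eval2 G x y = 0" if "eval2 F x y = 0" for x y
    using pderiv_eval2[of F x y] that F by (simp add: G_def)
  moreover have "tdeg_le G d" unfolding G_def using deg by (rule tdeg_le_map_poly) simp
  ultimately show ?thesis using that by blast
qed

section \<open>Primes of a given size\<close>

text \<open>The ring \<open>F\<^sub>q[T]/P\<close> enters only through the representatives in \<open>low_degree (degree P)\<close>.\<close>

lemma card_roots_mod_prime_le:
  fixes P :: "'k::{field,finite} poly"
  assumes P: "prime_elem P" and f: "\<not> P dvd lead_coeff f"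
  shows "card {y \<in> low_degree (degree P). P dvd poly f y} \<le> degree f"
  using f
proof (induction "degree f" arbitrary: f)
  case 0
  then obtain c where "f = [:c:]" by (metis degree_eq_zeroE)
  with 0 show ?case by simp
next
  case (Suc n)
  let ?Y = "\<lambda>f. {y \<in> low_degree (degree P). P dvd poly f y}"
  have fin: "finite (?Y f)" for f by simp
  show ?case
  proof (cases "?Y f = {}")
    case False
    then obtain a where a: "a \<in> low_degree (degree P)" "P dvd poly f a" by auto
    \<comment> \<open>Splitting off a root modulo \<open>P\<close> preserves the leading
      coefficient, so the induction hypothesis applies to the quotient.\<close>
    define g where "g = synthetic_div f a"
    have fg: "f = [:- a, 1:] * g + [:poly f a:]"
      unfolding g_def by (rule synthetic_div_correct'[symmetric])
    have degg: "degree g = n" unfolding g_def using Suc.hyps(2) by (simp add: degree_synthetic_div)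
    have "lead_coeff f = coeff ([:- a, 1:] * g + [:poly f a:]) (Suc n)"
      using fg Suc.hyps(2) by simp
    also have "\<dots> = lead_coeff g"
      using degg by (simp add: coeff_eq_0)
    finally have "\<not> P dvd lead_coeff g" using Suc.prems by simp
    then have IH: "card (?Y g) \<le> n" using Suc.hyps(1)[of g] degg by simp
    have "?Y f \<subseteq> insert a (?Y g)"
    proof
      fix y assume y: "y \<in> ?Y f"
      have "poly f y = (y - a) * poly g y + poly f a" by (subst fg) (simp add: algebra_simps)
      then have "P dvd (y - a) * poly g y" using y a(2) by (metis (mono_tags) dvd_add_left_iff mem_Collect_eq)
      then have "P dvd y - a \<or> P dvd poly g y" using P by (simp add: prime_elem_dvd_mult_iff)
      moreover have "y = a" if "P dvd y - a"
      proof (rule ccontr)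
        assume "y \<noteq> a"
        then have "degree P \<le> degree (y - a)" using that by (intro dvd_imp_degree_le) auto
        moreover have "y - a \<in> low_degree (degree P)" using y a(1) by (intro low_degree_diff) auto
        ultimately show False using \<open>y \<noteq> a\<close> by (simp add: low_degree_iff)
      qed
      ultimately show "y \<in> insert a (?Y g)" using y by auto
    qed
    then have "card (?Y f) \<le> card (insert a (?Y g))" using fin by (intro card_mono) auto
    also have "\<dots> \<le> Suc n" using IH fin by (simp add: card_insert_if)
    finally show ?thesis using Suc.hyps(2) by simp
  next
    case True
    then show ?thesis by (metis card.empty zero_le)
  qed
qed

section \<open>Frobenius modulo a prime and the supply of primes\<close>

context
  fixes q :: nat
  defines "q \<equiv> CARD('k::{field_gcd, finite_field})"
begin

text \<open>The polynomial \<open>(1 + X) ^ q - X ^ q - 1\<close> has degree below \<open>q\<close>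
  but vanishes at all \<open>q\<close> elements of the field, so it is zero. This gives additivity
  of the \<open>q\<close>-th power without writing \<open>q\<close> as a power of the
  characteristic.\<close>

lemma of_nat_choose_card_field:
  assumes "0 < i" "i < q"
  shows "of_nat (q choose i) = (0 :: 'k)"
proof -
  have q0: "0 < q" by (simp add: q_def)
  define D where "D = [:1, 1 :: 'k:] ^ q - monom 1 q - 1"
  have coeff_D: "coeff D i = (if 0 < i \<and> i < q then of_nat (q choose i) else 0)" for i
  proof -
    have "coeff ([:1, 1 :: 'k:] ^ q) i = of_nat (q choose i)"
      using coeff_linear_poly_power[of i q 1 "1 :: 'k"] by (cases "i \<le> q") (simp_all add: coeff_eq_0 degree_linear_power binomial_eq_0)
    then show ?thesis
      by (cases i q rule: linorder_cases) (use q0 in \<open>simp_all add: D_def binomial_eq_0\<close>)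
  qed
  have "D = 0"
  proof (rule ccontr)
    assume D: "D \<noteq> 0"
    have "poly D a = 0" for a
      by (simp add: D_def poly_monom q_def finite_field_power_card_eq_same)
    then have "q \<le> degree D" using card_poly_roots_bound[OF D] by (simp add: q_def)
    moreover have "degree D < q"
      using coeff_D by (intro degree_lessI) (auto simp: q_def D)
    ultimately show False by simp
  qed
  then show ?thesis using coeff_D[of i] assms by simp
qed

lemma freshmans_dream_card: "(x + y) ^ (q ^ m) = x ^ (q ^ m) + (y :: 'k poly) ^ (q ^ m)"
proof (induction m)
  case (Suc m)
  have *: "(x + y) ^ q = x ^ q + y ^ q" for x y :: "'k poly"
  proof -
    have q: "0 < q" by (simp add: q_def)
    have "(x + y) ^ q = (\<Sum>i\<le>q. of_nat (q choose i) * x ^ i * y ^ (q - i))"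
      by (rule binomial_ring)
    also have "\<dots> = (\<Sum>i\<in>{0, q}. of_nat (q choose i) * x ^ i * y ^ (q - i))"
      using of_nat_choose_card_field
      by (intro sum.mono_neutral_right) (auto simp: of_nat_poly)
    also have "\<dots> = x ^ q + y ^ q" using q by (simp add: add.commute)
    finally show ?thesis .
  qed
  have "(x + y) ^ (q ^ Suc m) = ((x + y) ^ (q ^ m)) ^ q"
    by (simp add: power_mult[symmetric] mult.commute)
  then show ?case
    by (simp add: Suc * power_mult[symmetric] mult.commute)
qed simp

lemma of_nat_card_field: "of_nat q = (0 :: 'k)"
  using of_nat_choose_card_field[of 1] one_less_card_field[where 'a = 'k] by (simp add: q_def)

text \<open>The power map is additive and fixes constants, so the congruence for \<open>T\<close>
  spreads to all polynomials by induction on their coefficients.\<close>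

lemma dvd_power_card_minus_self:
  assumes "P dvd monom 1 (q ^ m) - monom 1 1"
  shows "P dvd f ^ (q ^ m) - (f :: 'k poly)"
proof (induction f)
  case (pCons c f)
  let ?Q = "q ^ m" and ?T = "monom 1 1 :: 'k poly"
  have split: "pCons c f = [:c:] + ?T * f" by (simp add: monom_altdef)
  have "[:c:] ^ ?Q = [:c:]"
    using finite_field_power_card_power_eq_same[where x = c and n = m] by (simp add: poly_const_pow q_def)
  then have "pCons c f ^ ?Q = [:c:] + ?T ^ ?Q * f ^ ?Q"
    unfolding split by (simp add: freshmans_dream_card power_mult_distrib)
  then have "pCons c f ^ ?Q - pCons c f = ?T ^ ?Q * (f ^ ?Q - f) + (?T ^ ?Q - ?T) * f"
    unfolding split by (simp add: algebra_simps)
  moreover have "P dvd ?T ^ ?Q - ?T" using assms by (simp add: monom_power)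
  ultimately show ?case using pCons.IH by simp
qed (simp add: q_def zero_power)

text \<open>All \<open>q ^ degree P\<close> residues modulo \<open>P\<close> are roots of the monic
  polynomial \<open>Y ^ (q ^ m) - Y\<close>, which has at most \<open>q ^ m\<close> roots modulo
  \<open>P\<close>.\<close>

lemma degree_prime_dvd_frob_le:
  fixes P :: "'k poly"
  assumes P: "prime_elem P" "P dvd monom 1 (q ^ m) - monom 1 1" and m: "m > 0"
  shows "degree P \<le> m"
proof -
  have q: "1 < q" using one_less_card_field[where 'a = 'k] by (simp add: q_def)
  then have Q: "1 < q ^ m" using m by (rule one_less_power)
  define f :: "'k poly poly" where "f = monom 1 (q ^ m) - monom 1 1"
  have deg: "degree f = q ^ m"
  proof (rule antisym)
    show "degree f \<le> q ^ m"
      unfolding f_def using Q by (intro degree_diff_le) (auto intro: degree_monom_le order_trans)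
    show "q ^ m \<le> degree f" using Q by (intro le_degree) (simp add: f_def)
  qed
  have "lead_coeff f = 1" unfolding deg using Q by (simp add: f_def)
  then have "\<not> P dvd lead_coeff f" using P(1) by auto
  from card_roots_mod_prime_le[OF P(1) this]
  have "card {y \<in> low_degree (degree P). P dvd poly f y} \<le> q ^ m" by (simp add: deg)
  moreover have "{y \<in> low_degree (degree P). P dvd poly f y} = low_degree (degree P)"
    using dvd_power_card_minus_self[OF P(2)] by (auto simp: f_def poly_monom)
  ultimately have "q ^ degree P \<le> q ^ m" by (simp add: card_low_degree q_def)
  then show ?thesis using q by simp
qed

lemma degree_eq_sum_prime_factors:
  assumes "W \<noteq> (0 :: 'k poly)"
  shows "degree W = (\<Sum>p\<in>prime_factors W. multiplicity p W * degree p)"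
proof -
  have "degree W = degree (normalize W)"
    using assms by (intro antisym dvd_imp_degree_le) simp_all
  also have "normalize W = (\<Prod>p\<in>prime_factors W. p ^ multiplicity p W)"
    using prod_prime_factors[OF assms] by simp
  also have "degree \<dots> = (\<Sum>p\<in>prime_factors W. degree (p ^ multiplicity p W))"
    by (intro degree_prod_eq_sum_degree) auto
  also have "\<dots> = (\<Sum>p\<in>prime_factors W. multiplicity p W * degree p)"
    by (intro sum.cong refl degree_power_eq) auto
  finally show ?thesis .
qed

text \<open>The polynomial \<open>T ^ (q ^ m) - T\<close> is squarefree and all its prime factors have degree at
  most \<open>m\<close>; those of degree at most \<open>r\<close> are too few to account for its degree.\<close>

lemma many_primes:
  assumes "m > 0"
  obtains A :: "'k poly set" where "finite A"
    "\<And>P. P \<in> A \<Longrightarrow> prime P \<and> r < degree P \<and> degree P \<le> m"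
    "q ^ m \<le> r * q ^ (r + 1) + m * card A"
proof -
  have q: "1 < q" using one_less_card_field[where 'a = 'k] by (simp add: q_def)
  then have Q: "1 < q ^ m" using assms by (rule one_less_power)
  define W :: "'k poly" where "W = monom 1 (q ^ m) - monom 1 1"
  have deg: "q ^ m \<le> degree W" using Q by (intro le_degree) (simp add: W_def)
  then have W0: "W \<noteq> 0" using Q by (metis degree_0 not_less0 less_le_trans)
  \<comment> \<open>The factor \<open>q ^ m\<close> is zero in the field. A derivative that is a
    unit excludes square factors.\<close>
  have "pderiv W = - 1"
    using of_nat_card_field assms by (simp add: W_def pderiv_diff pderiv_monom flip: one_pCons monom_0)
  have mult: "multiplicity P W \<le> 1" if "prime P" for P
  proof -
    have "\<not> P ^ 2 dvd W"
    proof
      assume "P ^ 2 dvd W"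
      then obtain V where "W = P * (P * V)" by (metis dvdE mult.assoc power2_eq_square)
      then have "pderiv W = P * (P * pderiv V + 2 * pderiv P * V)"
        by (simp add: pderiv_mult algebra_simps)
      then have "P dvd - 1" using \<open>pderiv W = - 1\<close> by (metis dvd_triv_left)
      then show False using that by (simp add: not_prime_unit)
    qed
    then show ?thesis using that W0 by (metis multiplicity_dvd' not_less_eq_eq numeral_2_eq_2 One_nat_def)
  qed
  define A where "A = {P \<in> prime_factors W. r < degree P}"
  define B where "B = {P \<in> prime_factors W. degree P \<le> r}"
  have degP: "degree P \<le> m" if "P \<in> prime_factors W" for P
    using degree_prime_dvd_frob_le[of P m] that assms by (auto simp: W_def in_prime_factors_iff)
  \<comment> \<open>Counting all polynomials of degree at most \<open>r\<close> is crude but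
    harmless, since \<open>m - r\<close> will grow linearly in \<open>n\<close>.\<close>
  have B: "card B \<le> q ^ (r + 1)"
  proof -
    have "B \<subseteq> poly_box r" by (auto simp: B_def poly_box_def)
    then have "card B \<le> card (poly_box r :: 'k poly set)" by (rule card_mono[OF finite_poly_box])
    then show ?thesis by (simp add: card_poly_box q_def)
  qed
  have "q ^ m \<le> (\<Sum>P\<in>prime_factors W. multiplicity P W * degree P)"
    using deg degree_eq_sum_prime_factors[OF W0] by simp
  also have "\<dots> \<le> (\<Sum>P\<in>prime_factors W. degree P)"
    using mult by (intro sum_mono) (auto simp: in_prime_factors_iff)
  also have "prime_factors W = A \<union> B" by (auto simp: A_def B_def)
  also have "(\<Sum>P\<in>A \<union> B. degree P) = (\<Sum>P\<in>A. degree P) + (\<Sum>P\<in>B. degree P)"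
    by (rule sum.union_disjoint) (auto simp: A_def B_def)
  also have "(\<Sum>P\<in>A. degree P) \<le> card A * m"
    using degP by (intro sum_bounded_above[THEN order_trans]) (auto simp: A_def)
  also have "(\<Sum>P\<in>B. degree P) \<le> card B * r"
    by (intro sum_bounded_above[THEN order_trans]) (auto simp: B_def)
  also have "card B * r \<le> r * q ^ (r + 1)" using B by simp
  finally have "q ^ m \<le> r * q ^ (r + 1) + m * card A" by (simp add: algebra_simps)
  moreover have "finite A" by (simp add: A_def)
  moreover have "prime P \<and> r < degree P \<and> degree P \<le> m" if "P \<in> A" for P
    using that degP by (auto simp: A_def in_prime_factors_iff)
  ultimately show ?thesis using that by blast
qed

lemma prime_not_dvd:
  fixes W :: "'k poly"
  assumes W: "W \<noteq> 0" and A: "finite A" "\<And>P. P \<in> A \<Longrightarrow> prime P \<and> r \<le> degree P"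
    and less: "degree W < r * card A"
  shows "\<exists>P\<in>A. \<not> P dvd W"
proof (rule ccontr)
  assume "\<not> ?thesis"
  then have sub: "A \<subseteq> prime_factors W" using A W by (auto simp: in_prime_factors_iff)
  have "r * card A \<le> (\<Sum>P\<in>A. degree P)"
    using A(2) sum_bounded_below[of A r degree] by (auto simp: mult.commute)
  also have "\<dots> \<le> (\<Sum>P\<in>prime_factors W. degree P)"
    using sub by (intro sum_mono2) auto
  also have "\<dots> \<le> (\<Sum>P\<in>prime_factors W. multiplicity P W * degree P)"
    using W by (intro sum_mono) (auto simp: prime_factors_multiplicity)
  also have "\<dots> = degree W" using degree_eq_sum_prime_factors[OF W] by simp
  finally show False using less by simp
qed

end

section \<open>The auxiliary polynomial\<close>

lemma dvd_poly_diff: "a dvd x - y \<Longrightarrow> a dvd poly p x - poly p y" for a :: "'a::comm_ring_1"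
proof (induction p)
  case (pCons c p)
  have "poly (pCons c p) x - poly (pCons c p) y = x * (poly p x - poly p y) + (x - y) * poly p y"
    by (simp add: algebra_simps)
  with pCons show ?case by simp
qed simp

lemma dvd_eval2_diff:
  assumes "a dvd x - x'" "a dvd y - (y' :: 'a::comm_ring_1)"
  shows "a dvd eval2 F x y - eval2 F x' y'"
proof (induction F)
  case (pCons p F)
  have "eval2 (pCons p F) x y - eval2 (pCons p F) x' y'
      = (poly p x - poly p x') + (y * (eval2 F x y - eval2 F x' y') + (y - y') * eval2 F x' y')"
    by (simp add: algebra_simps)
  then show ?case
    using pCons.IH assms dvd_poly_diff[OF assms(1)] by (simp only: dvd_add dvd_mult dvd_mult2)
qed simp

text \<open>Leaving the quadratic remainder unspecified avoids division by factorials, so the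
  expansion is valid in every characteristic.\<close>

lemma eval2_taylor:
  fixes x y s :: "'a::idom"
  shows "\<exists>k. eval2 F x y = eval2 F x s + (y - s) * eval2 (pderiv F) x s + (y - s) ^ 2 * k"
proof (induction F)
  case (pCons p F)
  then obtain k where k: "eval2 F x y = eval2 F x s + (y - s) * eval2 (pderiv F) x s + (y - s) ^ 2 * k"
    by blast
  show ?case
    by (rule exI[of _ "eval2 (pderiv F) x s + y * k"])
      (simp add: k pderiv_pCons algebra_simps power2_eq_square)
qed simp

text \<open>\<open>subst_graph x0 \<psi> F\<close> is \<open>F(x0 + U, \<psi>(U))\<close> as a polynomial in \<open>U\<close>.\<close>

definition subst_graph :: "'a::comm_ring_1 \<Rightarrow> 'a poly \<Rightarrow> 'a poly poly \<Rightarrow> 'a poly" where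
  "subst_graph x0 \<psi> F = poly (map_poly (\<lambda>p. pcompose p [:x0, 1:]) F) \<psi>"

lemma poly_subst_graph: "poly (subst_graph x0 \<psi> F) u = eval2 F (x0 + u) (poly \<psi> u)"
  unfolding subst_graph_def
  by (induction F) (simp_all add: map_poly_pCons poly_pcompose)

text \<open>Newton's iteration with a fixed approximate inverse \<open>b\<close> of the derivative.\<close>

lemma hensel_graph:
  fixes F :: "'a::idom poly poly"
  assumes b: "P dvd b * eval2 (pderiv F) x0 y0 - 1"
  shows "\<exists>\<psi>. \<forall>x y. eval2 F x y = 0 \<longrightarrow> P dvd x - x0 \<longrightarrow> P dvd y - y0 \<longrightarrow>
    P ^ Suc M dvd y - poly \<psi> (x - x0)"
proof (induction M)
  case 0
  show ?case by (rule exI[of _ "[:y0:]"]) simp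
next
  case (Suc M)
  then obtain \<psi> where \<psi>: "\<And>x y. eval2 F x y = 0 \<Longrightarrow> P dvd x - x0 \<Longrightarrow> P dvd y - y0 \<Longrightarrow>
    P ^ Suc M dvd y - poly \<psi> (x - x0)" by blast
  show ?case
  proof (intro exI[of _ "\<psi> - smult b (subst_graph x0 \<psi> F)"] allI impI)
    fix x y assume xy: "eval2 F x y = 0" "P dvd x - x0" "P dvd y - y0"
    define s where "s = poly \<psi> (x - x0)"
    have s: "P ^ Suc M dvd y - s" unfolding s_def by (rule \<psi>[OF xy])
    then have Ps: "P dvd y - s" by (metis dvd_trans dvd_triv_left power_Suc)
    then have "P dvd s - y0" using xy(3) by (metis dvd_diff_right_iff diff_diff_eq2 diff_add_cancel add_diff_cancel_left' dvd_diff)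
    define D where "D = eval2 (pderiv F) x s"
    have "P dvd D - eval2 (pderiv F) x0 y0"
      unfolding D_def using xy(2) \<open>P dvd s - y0\<close> by (rule dvd_eval2_diff)
    then have "P dvd b * (D - eval2 (pderiv F) x0 y0) + (b * eval2 (pderiv F) x0 y0 - 1)"
      using b by (intro dvd_add dvd_mult)
    then have bD: "P dvd b * D - 1" by (simp add: algebra_simps)
    obtain k where "0 = eval2 F x s + (y - s) * D + (y - s) ^ 2 * k"
      using eval2_taylor[of F x y s] xy(1) by (auto simp: D_def)
    then have eq: "eval2 F x s = - ((y - s) * D + (y - s) ^ 2 * k)"
      by (metis add.assoc eq_neg_iff_add_eq_0)
    have "y - poly (\<psi> - smult b (subst_graph x0 \<psi> F)) (x - x0) = y - s + b * eval2 F x s"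
      by (simp add: poly_subst_graph s_def)
    \<comment> \<open>Both error terms gain a factor \<open>P\<close>: the first from
      \<open>b * D - 1\<close>, the second from the additional \<open>y - s\<close>.\<close>
    also have "\<dots> = - ((y - s) * (b * D - 1) + (y - s) * (y - s) * (b * k))"
      unfolding eq by (simp add: algebra_simps power2_eq_square)
    finally have "y - poly (\<psi> - smult b (subst_graph x0 \<psi> F)) (x - x0)
        = - ((y - s) * (b * D - 1) + (y - s) * (y - s) * (b * k))" .
    moreover have "P ^ Suc M * P dvd (y - s) * (b * D - 1)" using s bD by (rule mult_dvd_mono)
    moreover have "P ^ Suc M * P dvd (y - s) * (y - s)" using s Ps by (rule mult_dvd_mono)
    ultimately show "P ^ Suc (Suc M) dvd y - poly (\<psi> - smult b (subst_graph x0 \<psi> F)) (x - x0)"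
      by (simp add: mult.commute mult.left_commute)
  qed
qed

lemma inverse_mod_prime:
  fixes P :: "'k::field_gcd poly"
  assumes "prime P" "\<not> P dvd a"
  obtains b where "P dvd b * a - 1"
proof -
  have "coprime P a" using assms by (rule prime_imp_coprime)
  moreover obtain u v where "u * P + v * a = gcd P a" by (metis bezout_coefficients_fst_snd)
  ultimately have "v * a - 1 = P * (- u)" by (simp add: algebra_simps coprime_iff_gcd_eq_1)
  then show ?thesis using that by (metis dvd_triv_left)
qed

section \<open>Polynomials supported on a box of monomials\<close>

definition box_poly :: "nat \<Rightarrow> nat \<Rightarrow> (nat \<times> nat \<Rightarrow> 'a) \<Rightarrow> 'a::comm_ring_1 poly poly" where
  "box_poly A d c = (\<Sum>(i, j)\<in>{..<A} \<times> {..<d}. monom (monom (c (i, j)) i) j)"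

lemma eval2_sum: "eval2 (sum f S) x y = (\<Sum>s\<in>S. eval2 (f s) x y)"
  by (induction S rule: infinite_finite_induct) simp_all

lemma eval2_monom: "eval2 (monom (monom c i) j) x y = c * x ^ i * y ^ j"
  by (simp add: eval2_def poly_monom poly_power)

lemma eval2_box_poly:
  "eval2 (box_poly A d c) x y = (\<Sum>(i, j)\<in>{..<A} \<times> {..<d}. c (i, j) * x ^ i * y ^ j)"
  unfolding box_poly_def eval2_sum by (intro sum.cong) (auto simp: eval2_monom)

lemma coeff_box_poly:
  "coeff (coeff (box_poly A d c) j) i = (if i < A \<and> j < d then c (i, j) else 0)"
proof -
  have "coeff (coeff (box_poly A d c) j) i
      = (\<Sum>z\<in>{..<A} \<times> {..<d}. if z = (i, j) then c (i, j) else 0)"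
    unfolding box_poly_def coeff_sum by (intro sum.cong refl) (auto simp: case_prod_beta)
  then show ?thesis by simp
qed

lemma degree_box_poly_diff:
  assumes "d > 0" "A > 0"
  shows "degree (box_poly A d c - box_poly A d c') < d"
    "degree (coeff (box_poly A d c - box_poly A d c') j) < A"
proof -
  have *: "coeff (coeff (box_poly A d c - box_poly A d c') j) i = 0" if "j \<ge> d \<or> i \<ge> A" for i j
    using that by (auto simp: coeff_box_poly)
  show "degree (box_poly A d c - box_poly A d c') < d"
    using assms * by (intro degree_lessI) (auto simp: poly_eq_iff)
  show "degree (coeff (box_poly A d c - box_poly A d c') j) < A"
    using assms * by (intro degree_lessI) auto
qed

lemma box_poly_diff_ne_0:
  assumes "c \<in> PiE ({..<A} \<times> {..<d}) B" "c' \<in> PiE ({..<A} \<times> {..<d}) B" "c \<noteq> c'"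
  shows "box_poly A d c - box_poly A d c' \<noteq> 0"
proof
  assume eq: "box_poly A d c - box_poly A d c' = 0"
  have "c z = c' z" if "z \<in> {..<A} \<times> {..<d}" for z
    using that arg_cong[OF eq, of "\<lambda>G. coeff (coeff G (snd z)) (fst z)"]
    by (auto simp: coeff_box_poly)
  then have "c = c'" using PiE_ext[OF assms(1,2)] by blast
  with assms(3) show False by simp
qed

text \<open>The subtraction is truncated: if \<open>(i + j) * n \<ge> L\<close>, the coefficient is \<open>0\<close>.\<close>

lemma eval2_box_poly_low_degree:
  fixes x y :: "'k::field poly"
  assumes "x \<in> poly_box n" "y \<in> poly_box n"
    and c: "\<And>i j. i < A \<Longrightarrow> j < d \<Longrightarrow> c (i, j) \<in> low_degree (L - (i + j) * n)"
  shows "eval2 (box_poly A d c) x y \<in> low_degree L"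
proof -
  have sum: "sum f S \<in> low_degree L" if "\<And>s. s \<in> S \<Longrightarrow> f s \<in> low_degree L"
    for f :: "nat \<times> nat \<Rightarrow> 'k poly" and S
    using that by (auto simp: low_degree_def coeff_sum intro!: sum.neutral)
  show ?thesis unfolding eval2_box_poly
  proof (rule sum, clarify)
    fix i j assume ij: "i < A" "j < d"
    have "degree (x ^ i * y ^ j) \<le> n * i + n * j"
      using assms(1,2) unfolding poly_box_def
      by (intro order_trans[OF degree_mult_le] add_mono order_trans[OF degree_power_le] mult_right_mono) auto
    then have "degree (x ^ i * y ^ j) \<le> (i + j) * n" by (simp add: algebra_simps)
    then show "c (i, j) * x ^ i * y ^ j \<in> low_degree L"
      using c[OF ij] degree_mult_le[of "c (i, j)" "x ^ i * y ^ j"]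
      by (auto simp: low_degree_iff mult.assoc)
  qed
qed

text \<open>The factor \<open>u ^ k\<close> already contributes \<open>P ^ k\<close>. This halves,
  to leading order, the cost of requiring every coefficient below \<open>M\<close> to be divisible
  by \<open>P ^ M\<close>.\<close>

lemma prime_power_dvd_poly:
  assumes "\<And>k. k < M \<Longrightarrow> P ^ (M - k) dvd coeff f k" "P dvd u"
  shows "P ^ M dvd poly f (u :: 'a::comm_ring_1)"
  unfolding poly_altdef
proof (rule dvd_sum)
  fix k
  show "P ^ M dvd coeff f k * u ^ k"
  proof (cases "k < M")
    case True
    then have "P ^ (M - k) * P ^ k dvd coeff f k * u ^ k"
      using assms by (intro mult_dvd_mono dvd_power_same) auto
    with True show ?thesis by (simp flip: power_add)
  next
    case False
    then have "P ^ M dvd P ^ k" by (intro le_imp_power_dvd) simp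
    also have "P ^ k dvd coeff f k * u ^ k"
      using assms(2) by (intro dvd_mult dvd_power_same)
    finally show ?thesis .
  qed
qed

text \<open>On a residue disc around a nonsingular point mod \<open>P\<close> the curve is a graph, so that a
  polynomial restricted to it has an expansion \<open>\<Sum> c\<^sub>k (P u)\<^sup>k\<close>, and divisibility by \<open>P ^ M\<close> costs
  only \<open>\<Sum>\<^bsub>k<M\<^esub> (M - k) * degree P\<close> linear conditions.\<close>

lemma auxiliary_polynomial:
  fixes F :: "'k::{field_gcd,finite} poly poly poly"
  assumes P: "prime P" and sing: "\<not> P dvd eval2 (pderiv F) x0 y0"
    and A: "A > 0" "d > 0"
    and less: "(\<Sum>k<M. degree P * (M - k)) < (\<Sum>(i, j)\<in>{..<A} \<times> {..<d}. M * degree P - (i + j) * n)"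
  obtains G where "G \<noteq> 0" "degree G < d" "\<And>j. degree (coeff G j) < A"
    "\<And>x y. x \<in> poly_box n \<Longrightarrow> y \<in> poly_box n \<Longrightarrow> eval2 F x y = 0 \<Longrightarrow>
      P dvd x - x0 \<Longrightarrow> P dvd y - y0 \<Longrightarrow> eval2 G x y = 0"
proof -
  have P0: "P \<noteq> 0" using P by auto
  obtain b where "P dvd b * eval2 (pderiv F) x0 y0 - 1" using inverse_mod_prime[OF P sing] .
  from hensel_graph[OF this] obtain \<psi> where
    \<psi>': "\<And>x y. eval2 F x y = 0 \<Longrightarrow> P dvd x - x0 \<Longrightarrow> P dvd y - y0 \<Longrightarrow> P ^ Suc M dvd y - poly \<psi> (x - x0)"
    by blast
  have \<psi>: "P ^ M dvd y - poly \<psi> (x - x0)" if "eval2 F x y = 0" "P dvd x - x0" "P dvd y - y0" for x y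
    using \<psi>'[OF that] by (metis dvd_trans dvd_triv_right power_Suc)
  \<comment> \<open>\<open>L\<close> is the degree of \<open>P ^ M\<close>. The coefficient of
    \<open>X ^ i * Y ^ j\<close> is given length \<open>L - (i + j) * n\<close>, so that values on
    the box stay below degree \<open>L\<close>.\<close>
  define L where "L = M * degree P"
  define S where "S c = subst_graph x0 \<psi> (box_poly A d c)" for c
  let ?I = "{..<A} \<times> {..<d}" and ?h = "\<lambda>(i, j). L - (i + j) * n"
  have deg: "degree (P ^ k) = degree P * k" for k using P0 by (simp add: degree_power_eq mult.commute)
  obtain c c' where c: "c \<in> PiE ?I (\<lambda>z. low_degree (?h z))" "c' \<in> PiE ?I (\<lambda>z. low_degree (?h z))" "c \<noteq> c'"
    and eq: "\<And>k. k \<in> {..<M} \<Longrightarrow> coeff (S c) k mod P ^ (M - k) = coeff (S c') k mod P ^ (M - k)"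
  proof (rule low_degree_pigeonhole[of ?I "{..<M}" ?h "\<lambda>c k. coeff (S c) k mod P ^ (M - k)"
        "\<lambda>k. degree P * (M - k)"])
    show "coeff (S c) k mod P ^ (M - k) \<in> low_degree (degree P * (M - k))" for c k
      using mod_in_low_degree[of "P ^ (M - k)" "coeff (S c) k"] P0 by (simp add: deg)
    show "(\<Sum>k<M. degree P * (M - k)) < sum ?h ?I"
      using less by (simp add: L_def)
  qed auto
  define G where "G = box_poly A d c - box_poly A d c'"
  show ?thesis
  proof (rule that[of G])
    show "G \<noteq> 0" unfolding G_def using c by (rule box_poly_diff_ne_0)
    show "degree G < d" "\<And>j. degree (coeff G j) < A"
      unfolding G_def by (rule degree_box_poly_diff[OF A(2,1)])+
    fix x y assume xy: "x \<in> poly_box n" "y \<in> poly_box n" "eval2 F x y = 0"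
      "P dvd x - x0" "P dvd y - y0"
    have "P ^ M dvd poly (S c - S c') (x - x0)"
      using eq xy(4) by (intro prime_power_dvd_poly) (auto simp: mod_eq_dvd_iff)
    then have "P ^ M dvd eval2 G x (poly \<psi> (x - x0))"
      by (simp add: S_def G_def poly_subst_graph)
    moreover have "P ^ M dvd eval2 G x y - eval2 G x (poly \<psi> (x - x0))"
      using \<psi>[OF xy(3-5)] by (intro dvd_eval2_diff) auto
    ultimately have "P ^ M dvd eval2 G x y" by (metis dvd_add diff_add_cancel)
    moreover have "eval2 G x y \<in> low_degree L"
      unfolding G_def eval2_diff using xy(1,2) c(1,2)
      by (intro low_degree_diff eval2_box_poly_low_degree) (auto simp: PiE_iff)
    \<comment> \<open>A nonzero multiple of \<open>P ^ M\<close> would have degree at least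
      \<open>L\<close>.\<close>
    ultimately show "eval2 G x y = 0"
      using deg[of M] dvd_imp_degree_le[of "P ^ M" "eval2 G x y"]
      by (cases "eval2 G x y = 0") (simp_all add: low_degree_iff L_def mult.commute)
  qed
qed

section \<open>Counting points\<close>

lemma card_curve_mod_prime_le:
  fixes F :: "'k::{field,finite} poly poly poly"
  assumes P: "prime_elem P" and F: "degree F = d" "coeff F d = [:a:]" "\<not> P dvd a"
  defines "C \<equiv> {(x, y). x \<in> low_degree (degree P) \<and> y \<in> low_degree (degree P) \<and> P dvd eval2 F x y}"
  shows "finite C" "card C \<le> CARD('k) ^ degree P * d"
proof -
  let ?R = "low_degree (degree P) :: 'k poly set"
  define f where "f x = map_poly (\<lambda>p. poly p x) F" for x
  have C: "C = (SIGMA x:?R. {y \<in> ?R. P dvd poly (f x) y})"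
    by (auto simp: C_def f_def poly_section)
  show "finite C" unfolding C by (intro finite_SigmaI) auto
  have le: "card {y \<in> ?R. P dvd poly (f x) y} \<le> d" for x
  proof -
    have c: "coeff (f x) d = a" unfolding f_def using F(2) by (rule coeff_section)
    moreover have "a \<noteq> 0" using F(3) by auto
    ultimately have "d \<le> degree (f x)" by (intro le_degree) simp
    then have "degree (f x) = d"
      using degree_section_le[of x F] F(1) by (intro antisym) (simp_all add: f_def)
    then show ?thesis using card_roots_mod_prime_le[OF P, of "f x"] c F(3) by simp
  qed
  have "card C = (\<Sum>x\<in>?R. card {y \<in> ?R. P dvd poly (f x) y})"
    unfolding C by (intro card_SigmaI) auto
  also have "\<dots> \<le> (\<Sum>x\<in>?R. d)" using le by (intro sum_mono)
  finally show "card C \<le> CARD('k) ^ degree P * d" by (simp add: card_low_degree)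
qed

text \<open>Every irreducible curve can be brought into this form by a shear.\<close>

definition y_regular :: "'a::idom poly poly \<Rightarrow> nat \<Rightarrow> 'a \<Rightarrow> bool" where
  "y_regular F d a \<longleftrightarrow> prime_elem F \<and> d \<ge> 1 \<and> degree F = d \<and> coeff F d = [:a:] \<and> tdeg_le F d"

lemma y_regular_nz:
  assumes "y_regular F d a"
  shows "a \<noteq> 0"
proof
  assume "a = 0"
  then have "lead_coeff F = 0" using assms by (simp add: y_regular_def)
  then show False using assms by (auto simp: y_regular_def)
qed

lemma y_regular_not_dvd:
  assumes "y_regular F d a" "G \<noteq> 0" "degree G < d"
  shows "\<not> F dvd G"
  using assms dvd_imp_degree_le[of F G] by (auto simp: y_regular_def)

lemma y_regular_card_common_zeros:
  assumes F: "y_regular F d a" and G: "\<not> F dvd G" "degree G < e" "\<And>j. degree (coeff G j) \<le> l"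
    and Z: "Z \<subseteq> {(x, y). eval2 F x y = 0 \<and> eval2 G x y = 0}"
  shows "finite Z" "card Z \<le> d * (e * d + d * l)"
proof -
  have F': "prime_elem F" "degree F = d" "coeff F d = [:a:]" "d \<ge> 1"
    and "degree (coeff F j) \<le> d" for j
    using F tdeg_leD_degree(2)[of F d j] by (simp_all add: y_regular_def)
  note bound = card_common_zeros_le[OF this(1-5) G]
  show "finite Z" using Z bound(1) by (rule finite_subset)
  show "card Z \<le> d * (e * d + d * l)"
    using card_mono[OF bound(1) Z] bound(2) by (rule order_trans)
qed

text \<open>The factor \<open>q ^ degree P * d\<close> counts residue classes on the reduced curve;
  the remaining factor is the elimination bound for \<open>F\<close> and the auxiliary polynomial of
  a single class.\<close>

lemma card_points_nonsingular_mod_prime_le: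
  fixes F :: "'k::{field_gcd,finite} poly poly poly"
  assumes F: "y_regular F d a" and P: "prime P" "\<not> P dvd a" and A: "A > 0"
    and less: "(\<Sum>k<M. degree P * (M - k)) < (\<Sum>(i, j)\<in>{..<A} \<times> {..<d}. M * degree P - (i + j) * n)"
  shows "card {(x, y) \<in> curve_points F n. \<not> P dvd eval2 (pderiv F) x y}
    \<le> CARD('k) ^ degree P * d * (d * (d * d + d * A))"
proof -
  have P0: "P \<noteq> 0" and Pp: "prime_elem P" using P(1) by auto
  define C where "C = {(x, y). x \<in> low_degree (degree P) \<and> y \<in> low_degree (degree P) \<and> P dvd eval2 F x y}"
  have C: "finite C" "card C \<le> CARD('k) ^ degree P * d"
    unfolding C_def using card_curve_mod_prime_le[OF Pp] F P(2) by (auto simp: y_regular_def)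
  define C' where "C' = {(x, y) \<in> C. \<not> P dvd eval2 (pderiv F) x y}"
  have "C' \<subseteq> C" by (auto simp: C'_def)
  then have C': "finite C'" "card C' \<le> CARD('k) ^ degree P * d"
    using C(1) finite_subset order_trans[OF card_mono[OF C(1)] C(2)] by blast+
  define disc where
    "disc w = {(x, y) \<in> curve_points F n. P dvd x - fst w \<and> P dvd y - snd w}" for w
  have disc: "finite (disc w)" "card (disc w) \<le> d * (d * d + d * A)" if "w \<in> C'" for w
  proof -
    have sing: "\<not> P dvd eval2 (pderiv F) (fst w) (snd w)" using that by (auto simp: C'_def)
    obtain G where G: "G \<noteq> 0" "degree G < d" "\<And>j. degree (coeff G j) < A"
      "\<And>x y. x \<in> poly_box n \<Longrightarrow> y \<in> poly_box n \<Longrightarrow> eval2 F x y = 0 \<Longrightarrow>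
        P dvd x - fst w \<Longrightarrow> P dvd y - snd w \<Longrightarrow> eval2 G x y = 0"
    proof (rule auxiliary_polynomial[OF P(1) sing A _ less])
      show "0 < d" using F by (simp add: y_regular_def)
    qed blast
    have "disc w \<subseteq> {(x, y). eval2 F x y = 0 \<and> eval2 G x y = 0}"
      using G(4) by (auto simp: disc_def curve_points_def)
    from y_regular_card_common_zeros[OF F y_regular_not_dvd[OF F G(1,2)] G(2) less_imp_le[OF G(3)] this]
    show "finite (disc w)" "card (disc w) \<le> d * (d * d + d * A)" .
  qed
  let ?S = "{(x, y) \<in> curve_points F n. \<not> P dvd eval2 (pderiv F) x y}"
  have "?S \<subseteq> (\<Union>w\<in>C'. disc w)"
  proof clarify
    fix x y assume xy: "(x, y) \<in> curve_points F n" "\<not> P dvd eval2 (pderiv F) x y"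
    have cong: "P dvd x - x mod P" "P dvd y - y mod P" by (simp_all add: dvd_minus_mod)
    have "P dvd eval2 F (x mod P) (y mod P)"
      using dvd_eval2_diff[OF cong, of F] xy(1) by (simp add: curve_points_def)
    moreover have "\<not> P dvd eval2 (pderiv F) (x mod P) (y mod P)"
      using dvd_eval2_diff[OF cong, of "pderiv F"] xy(2) by (metis dvd_add diff_add_cancel)
    ultimately have "(x mod P, y mod P) \<in> C'"
      using mod_in_low_degree[OF P0] by (simp add: C'_def C_def)
    then show "(x, y) \<in> (\<Union>w\<in>C'. disc w)"
      using xy(1) cong by (force simp: disc_def)
  qed
  then have "card ?S \<le> card (\<Union>w\<in>C'. disc w)"
    using C'(1) disc(1) by (intro card_mono) auto
  also have "\<dots> \<le> (\<Sum>w\<in>C'. card (disc w))" using C'(1) by (rule card_UN_le)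
  also have "\<dots> \<le> (\<Sum>w\<in>C'. d * (d * d + d * A))" by (intro sum_mono disc)
  also have "\<dots> = card C' * (d * (d * d + d * A))" by simp
  also have "\<dots> \<le> CARD('k) ^ degree P * d * (d * (d * d + d * A))"
    using C'(2) by (rule mult_right_mono) simp
  finally show ?thesis .
qed

text \<open>Interpolation through \<open>E ^ 2 - 1\<close> points yields a polynomial \<open>G\<close> of controlled height with
  \<open>E ^ 2\<close> coefficients; \<open>E\<close> is chosen so that \<open>F\<close> and \<open>G\<close> have too many common zeros unless
  \<open>F dvd G\<close>.\<close>

lemma height_le_if_many_points:
  fixes F :: "'k::{field,finite} poly poly poly"
  assumes F: "y_regular F d a"
  defines "E \<equiv> 2 * d ^ 2 + 1"
  assumes many: "E ^ 2 - 1 \<le> card (curve_points F n)"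
  shows "height F \<le> 4 * E ^ 3 * n"
proof -
  have d: "d \<ge> 1" using F by (simp add: y_regular_def)
  then have E: "E > 1" by (simp add: E_def)
  \<comment> \<open>Coefficients have length at least \<open>H\<close>, values have length
    \<open>L = H + 2 * E * n\<close>. Since \<open>H\<close> exceeds
    \<open>(E ^ 2 - 1) * (2 * E * n)\<close>, the one surplus coefficient outweighs the extra length
    of all the values.\<close>
  define H where "H = 2 * E ^ 3 * n + 1"
  define L where "L = H + 2 * E * n"
  obtain S where S: "S \<subseteq> curve_points F n" "card S = E ^ 2 - 1" "finite S"
    using obtain_subset_with_card_n[OF many] by metis
  let ?I = "{..<E} \<times> {..<E}" and ?h = "\<lambda>(i, j). L - (i + j) * n"
  have less: "(\<Sum>s\<in>S. L) < sum ?h ?I"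
  proof -
    have "(E ^ 2 - 1) * (2 * E * n) < H"
    proof -
      have "(E ^ 2 - 1) * (2 * E * n) \<le> E ^ 2 * (2 * E * n)" by (intro mult_right_mono) auto
      also have "\<dots> = 2 * E ^ 3 * n" by (simp add: power2_eq_square power3_eq_cube)
      finally show ?thesis unfolding H_def by (simp only: less_Suc_eq_le Suc_eq_plus1[symmetric])
    qed
    then have "(E ^ 2 - 1) * L < (E ^ 2 - 1) * H + H" by (simp add: L_def distrib_left)
    also have "\<dots> = E ^ 2 * H" using E by (simp add: diff_mult_distrib)
    also have "\<dots> = (\<Sum>z\<in>?I. H)" by (simp add: power2_eq_square)
    also have "\<dots> \<le> sum ?h ?I"
    proof (intro sum_mono, clarify)
      fix i j assume "i < E" "j < E"
      then have "(i + j) * n \<le> 2 * E * n" by (intro mult_right_mono) auto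
      then show "H \<le> L - (i + j) * n" unfolding L_def by linarith
    qed
    finally show ?thesis using S(2) by simp
  qed
  obtain c c' where c: "c \<in> PiE ?I (\<lambda>z. low_degree (?h z))" "c' \<in> PiE ?I (\<lambda>z. low_degree (?h z))"
    "c \<noteq> c'"
    and eq: "\<And>s. s \<in> S \<Longrightarrow>
      eval2 (box_poly E E c) (fst s) (snd s) = eval2 (box_poly E E c') (fst s) (snd s)"
  proof (rule low_degree_pigeonhole[of ?I S ?h "\<lambda>c s. eval2 (box_poly E E c) (fst s) (snd s)" "\<lambda>_. L"])
    fix c :: "nat \<times> nat \<Rightarrow> 'k poly" and s
    assume "c \<in> PiE ?I (\<lambda>z. low_degree (?h z))" "s \<in> S"
    then show "eval2 (box_poly E E c) (fst s) (snd s) \<in> low_degree L"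
      using S(1) by (intro eval2_box_poly_low_degree) (auto simp: curve_points_def PiE_iff)
  qed (use S less in auto)
  define G where "G = box_poly E E c - box_poly E E c'"
  have G0: "G \<noteq> 0" unfolding G_def using c by (rule box_poly_diff_ne_0)
  have "F dvd G"
  proof (rule ccontr)
    assume "\<not> F dvd G"
    moreover have "degree G < E" "degree (coeff G j) \<le> E" for j
      unfolding G_def using degree_box_poly_diff[of E E c c'] E by (simp_all add: less_imp_le)
    moreover have "S \<subseteq> {(x, y). eval2 F x y = 0 \<and> eval2 G x y = 0}"
      using S(1) eq by (force simp: G_def curve_points_def)
    ultimately have "card S \<le> d * (E * d + d * E)"
      by (intro y_regular_card_common_zeros[OF F])
    \<comment> \<open>This fixes \<open>E\<close>: with \<open>E - 1 = 2 * d ^ 2\<close> the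
      elimination bound becomes \<open>E * (E - 1)\<close>, which is below the number of
      interpolated points.\<close>
    also have "\<dots> = E * (E - 1)" by (simp add: E_def power2_eq_square algebra_simps)
    also have "\<dots> < E ^ 2 - 1"
    proof -
      have "E < E * E" using E by simp
      then show ?thesis
        using E unfolding power2_eq_square diff_mult_distrib2 mult_1_right by linarith
    qed
    finally show False using S(2) by simp
  qed
  then have "height F \<le> height G" using G0 by (rule nonarch_dvd_le[OF nonarch_height])
  also have "\<dots> \<le> L - 1"
  proof (rule height_le)
    fix i j
    have "coeff (coeff G j) i \<in> low_degree L"
    proof (cases "i < E \<and> j < E")
      case True
      then have "c (i, j) \<in> low_degree (L - (i + j) * n)" "c' (i, j) \<in> low_degree (L - (i + j) * n)"
        using c(1,2) by (auto simp: PiE_iff)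
      then have "c (i, j) \<in> low_degree L" "c' (i, j) \<in> low_degree L"
        by (auto simp: low_degree_iff)
      then show ?thesis using True by (simp add: G_def coeff_box_poly low_degree_diff)
    next
      case False
      then show ?thesis by (auto simp: G_def coeff_box_poly low_degree_def)
    qed
    then show "degree (coeff (coeff G j) i) \<le> L - 1" by (auto simp: low_degree_iff)
  qed
  also have "\<dots> \<le> 4 * E ^ 3 * n"
  proof -
    have "E * n \<le> E ^ 3 * n" using E by (intro mult_right_mono) (simp_all add: self_le_power)
    then show ?thesis by (simp add: L_def H_def)
  qed
  finally show ?thesis .
qed

lemma degree_eval2_le:
  fixes x y :: "'k::field poly"
  assumes h: "\<And>i j. degree (coeff (coeff F j) i) \<le> h"
    and F: "degree F \<le> e" "\<And>j. degree (coeff F j) \<le> l"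
    and xy: "x \<in> poly_box n" "y \<in> poly_box n"
  shows "degree (eval2 F x y) \<le> h + (l + e) * n"
  unfolding eval2_altdef
proof (intro degree_sum_le finite_atMost)
  fix i j assume "j \<in> {..degree F}" "i \<in> {..degree (coeff F j)}"
  then have ij: "i \<le> l" "j \<le> e" using F(1) F(2)[of j] by simp_all
  have "degree (coeff (coeff F j) i * x ^ i * y ^ j)
      \<le> degree (coeff (coeff F j) i) + degree (x ^ i) + degree (y ^ j)"
    by (metis add_right_mono degree_mult_le order_trans)
  also have "\<dots> \<le> h + n * i + n * j"
    using h xy unfolding poly_box_def
    by (intro add_mono order_trans[OF degree_power_le] mult_right_mono) auto
  also have "\<dots> \<le> h + (l + e) * n"
  proof -
    have "n * i \<le> l * n" "n * j \<le> e * n" using ij by (simp_all add: mult.commute)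
    then show ?thesis unfolding add_mult_distrib by linarith
  qed
  finally show "degree (coeff (coeff F j) i * x ^ i * y ^ j) \<le> h + (l + e) * n" .
qed

text \<open>The product is bounded because the same prime has to avoid both factors:
  \<open>a\<close>, so that reduction keeps the degree in \<open>Y\<close>, and the derivative, so
  that the point stays nonsingular.\<close>

lemma degree_lead_coeff_pderiv_le:
  fixes F :: "'k::{field,finite} poly poly poly"
  assumes F: "y_regular F d a" and xy: "x \<in> poly_box n" "y \<in> poly_box n"
  shows "degree (a * eval2 (pderiv F) x y) \<le> 2 * height F + 2 * d * n"
proof -
  have F': "degree F = d" "degree (coeff F j) \<le> d" "coeff F d = [:a:]" for j
    using F tdeg_leD_degree(2)[of F d j] by (simp_all add: y_regular_def)
  have pd: "coeff (pderiv F) j = smult (of_nat (Suc j)) (coeff F (Suc j))" for j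
    by (simp add: coeff_pderiv of_nat_poly)
  have "degree (eval2 (pderiv F) x y) \<le> height F + (d + d) * n"
  proof (rule degree_eval2_le[OF _ _ _ xy])
    fix i j
    have "degree (coeff (coeff (pderiv F) j) i) \<le> degree (coeff (coeff F (Suc j)) i)"
      unfolding pd by (simp add: of_nat_poly del: of_nat_Suc)
    also have "\<dots> \<le> height F" by (rule degree_coeff_le_height)
    finally show "degree (coeff (coeff (pderiv F) j) i) \<le> height F" .
    show "degree (coeff (pderiv F) j) \<le> d" for j
      unfolding pd using F'(2)[of "Suc j"] degree_smult_le order_trans by blast
    show "degree (pderiv F) \<le> d" using degree_pderiv_le[of F] F'(1) by simp
  qed
  moreover have "degree a \<le> height F"
    using degree_coeff_le_height[of F d 0] F'(3) by simp
  ultimately show ?thesis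
    using degree_mult_le[of a "eval2 (pderiv F) x y"] by (simp add: algebra_simps)
qed

section \<open>Choice of the numerical parameters\<close>

lemma sum_box:
  "(\<Sum>(i, j)\<in>{..<A} \<times> {..<d}. real (i + j)) = real A * real d * (real A + real d - 2) / 2"
proof -
  have S: "(\<Sum>i<m. real i) = real m * (real m - 1) / 2" for m
    by (induction m) (simp_all add: field_simps)
  have "(\<Sum>(i, j)\<in>{..<A} \<times> {..<d}. real (i + j)) = (\<Sum>i<A. \<Sum>j<d. real i + real j)"
    by (simp add: sum.cartesian_product)
  also have "\<dots> = real d * (\<Sum>i<A. real i) + real A * (\<Sum>j<d. real j)"
    by (simp add: sum.distrib sum_distrib_left)
  also have "\<dots> = real A * real d * (real A + real d - 2) / 2"
    unfolding S by (simp add: field_simps)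
  finally show ?thesis .
qed

lemma sum_diff_lessThan: "(\<Sum>k<M. real (M - k)) = real M * (real M + 1) / 2"
proof -
  have "(\<Sum>k<M. real (M - k)) = (\<Sum>k<M. real (Suc k))"
    by (rule sum.reindex_bij_witness[of _ "\<lambda>k. M - Suc k" "\<lambda>k. M - Suc k"]) auto
  also have "\<dots> = real M * (real M + 1) / 2"
    by (induction M) (simp_all add: field_simps)
  finally show ?thesis .
qed

text \<open>The choice \<open>M = d * A\<close> maximises, to leading order, the
  \<open>A * d * M * \<mu>\<close> available coefficients minus the \<open>\<mu> * M ^ 2 / 2\<close>
  conditions.\<close>

lemma parameter_count:
  fixes \<mu> n A d :: nat
  assumes "A > 0" "d > 0" and less: "real n * (real A + real d - 2) < real \<mu> * (real d * real A - 1)"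
  defines "M \<equiv> d * A"
  shows "(\<Sum>k<M. \<mu> * (M - k)) < (\<Sum>(i, j)\<in>{..<A} \<times> {..<d}. M * \<mu> - (i + j) * n)"
proof -
  have M: "real M > 0" using assms(1,2) by (simp add: M_def)
  have "real (\<Sum>k<M. \<mu> * (M - k)) = real \<mu> * (\<Sum>k<M. real (M - k))"
    by (simp add: sum_distrib_left)
  also have "\<dots> = real M * (real \<mu> * (real M + 1) / 2)"
    by (simp only: sum_diff_lessThan) simp
  also have "\<dots> < real M * (real M * real \<mu> - real n * (real A + real d - 2) / 2)"
    using less by (intro mult_strict_left_mono[OF _ M]) (simp add: M_def field_simps)
  also have "\<dots> = (\<Sum>z\<in>{..<A} \<times> {..<d}. real M * real \<mu>) - real n * (\<Sum>(i, j)\<in>{..<A} \<times> {..<d}. real (i + j))"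
    unfolding sum_box by (simp add: M_def field_simps)
  also have "\<dots> = (\<Sum>(i, j)\<in>{..<A} \<times> {..<d}. real M * real \<mu> - real n * real (i + j))"
    by (simp add: sum_subtractf sum_distrib_left case_prod_beta)
  also have "\<dots> \<le> (\<Sum>(i, j)\<in>{..<A} \<times> {..<d}. real (M * \<mu> - (i + j) * n))"
  proof (intro sum_mono, clarify)
    fix i j
    have "real M * real \<mu> - real n * real (i + j) = real (M * \<mu>) - real ((i + j) * n)" by simp
    \<comment> \<open>Subtraction of naturals stops at 0, so the real difference is a lower
      bound.\<close>
    then show "real M * real \<mu> - real n * real (i + j) \<le> real (M * \<mu> - (i + j) * n)" by linarith
  qed
  also have "\<dots> = real (\<Sum>(i, j)\<in>{..<A} \<times> {..<d}. M * \<mu> - (i + j) * n)"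
    by (simp add: case_prod_beta)
  finally show ?thesis by (simp only: of_nat_less_iff)
qed

text \<open>Inserting \<open>\<mu> = (1 / d + \<eta>) * n\<close> and dividing by \<open>n\<close>,
  the terms \<open>A\<close> cancel and \<open>d - 2 + 1 / d + \<eta> < \<eta> * d * A\<close>
  remains; as \<open>1 / d \<le> 1\<close>, the lower bound on \<open>A\<close> is enough.\<close>

lemma window_inequality:
  fixes \<eta> \<mu> n A d :: real
  assumes d: "d \<ge> 1" and "n > 0" and \<eta>: "\<eta> > 0" and \<mu>: "(1 / d + \<eta>) * n < \<mu>"
    and A: "(d + \<eta>) / (\<eta> * d) < A"
  shows "n * (A + d - 2) < \<mu> * (d * A - 1)"
proof -
  define t where "t = 1 / d"
  have t: "t * d = 1" "t \<le> 1" "t > 0" using d by (simp_all add: t_def)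
  have "d + \<eta> < \<eta> * d * A" using A \<eta> d by (simp add: field_simps)
  moreover have "(t + \<eta>) * (d * A - 1) = t * d * A + \<eta> * d * A - t - \<eta>"
    by (simp add: algebra_simps)
  ultimately have 1: "A + d - 2 < (t + \<eta>) * (d * A - 1)" using t by simp
  have "d * A - 1 > 0"
  proof -
    have "\<eta> * 1 < \<eta> * (d * A)" using \<open>d + \<eta> < \<eta> * d * A\<close> d by (simp add: mult.assoc)
    then show ?thesis using \<eta> by simp
  qed
  have "n * (A + d - 2) < n * ((t + \<eta>) * (d * A - 1))"
    using 1 \<open>n > 0\<close> by (rule mult_strict_left_mono)
  also have "\<dots> = (t + \<eta>) * n * (d * A - 1)" by simp
  also have "\<dots> \<le> \<mu> * (d * A - 1)"
    using \<mu> \<open>d * A - 1 > 0\<close> by (intro mult_right_mono) (auto simp: t_def)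
  finally show ?thesis .
qed

text \<open>The base 2 stands for the smallest possible field, so \<open>n0\<close> does not depend
  on the field. The inequality \<open>n \<le> d * r n\<close> serves to turn degree bounds linear in
  \<open>n\<close> into multiples of \<open>r n\<close>.\<close>

lemma eventually_parameters:
  fixes \<eta> :: real and K d :: nat
  assumes "\<eta> > 0" "d \<ge> 1"
  defines "r \<equiv> \<lambda>n. nat \<lfloor>(1 / d + \<eta>) * real n\<rfloor>" and "m \<equiv> \<lambda>n. nat \<lfloor>(1 / d + 2 * \<eta>) * real n\<rfloor>"
  shows "\<exists>n0>0. \<forall>n\<ge>n0. n \<le> d * r n \<and> r n < m n \<and> r n + m n * K < 2 ^ (m n - r n - 1)"
proof -
  define b where "b = (2 + 2 * \<eta>) * (real K + 1)"
  have "b > 0" using assms(1) by (simp add: b_def)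
  \<comment> \<open>Of the \<open>- 2\<close> in the exponent, one unit pays for the rounding of
    \<open>r\<close> and \<open>m\<close>, the other for the \<open>- 1\<close> in
    \<open>m n - r n - 1\<close>.\<close>
  have "eventually (\<lambda>x :: real. b * x < 2 powr (\<eta> * x - 2)) at_top"
    using assms(1) \<open>b > 0\<close> by real_asymp
  moreover have "eventually (\<lambda>x :: real. \<eta> * x > 3) at_top"
    using assms(1) by real_asymp
  ultimately have "eventually (\<lambda>x :: real. b * x < 2 powr (\<eta> * x - 2) \<and> \<eta> * x > 3) at_top"
    by eventually_elim simp
  then obtain X where X: "\<And>x :: real. x \<ge> X \<Longrightarrow> b * x < 2 powr (\<eta> * x - 2) \<and> \<eta> * x > 3"
    by (auto simp: eventually_at_top_linorder)
  define n0 where "n0 = nat \<lceil>X\<rceil> + 1"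
  have "n \<le> d * r n \<and> r n < m n \<and> r n + m n * K < 2 ^ (m n - r n - 1)" if "n \<ge> n0" for n
  proof -
    have "X \<le> real n" using that unfolding n0_def by linarith
    from X[OF this] have n: "b * real n < 2 powr (\<eta> * real n - 2)" "\<eta> * real n > 3" by auto
    let ?u = "(1 / d + \<eta>) * real n" and ?v = "(1 / d + 2 * \<eta>) * real n"
    have uv: "?u = real n / d + \<eta> * real n" "?v = real n / d + 2 * (\<eta> * real n)"
      by (simp_all add: field_simps)
    have "real n / d \<ge> 0" by simp
    then have u0: "?u \<ge> 0" "?v \<ge> 0" using n(2) uv by auto
    have r: "real (r n) \<le> ?u" "?u < real (r n) + 1" using u0(1) unfolding r_def by linarith+
    have m: "real (m n) \<le> ?v" "?v < real (m n) + 1" using u0(2) unfolding m_def by linarith+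
    have "real n / d \<le> real (r n)" using r(2) n(2) uv(1) by linarith
    then have "real n \<le> real d * real (r n)" using assms(2) by (simp add: field_simps)
    then have 1: "n \<le> d * r n" by (simp flip: of_nat_mult)
    have rm: "real (r n) + \<eta> * real n - 1 < real (m n)" using r(1) m(2) uv by linarith
    then have 2: "r n < m n" using n(2) by linarith
    have "real n / d \<le> real n"
      using assms(2) mult_left_mono[of 1 "real d" "real n"] by (simp add: divide_le_eq)
    then have "real (m n) \<le> (1 + 2 * \<eta>) * real n" using m(1) uv(2) by (simp add: algebra_simps)
    also have "\<dots> \<le> (2 + 2 * \<eta>) * real n" by (intro mult_right_mono) auto
    finally have mle: "real (m n) \<le> (2 + 2 * \<eta>) * real n" .
    have "real (r n + m n * K) \<le> real (m n) * (real K + 1)" using 2 by (simp add: algebra_simps)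
    also have "\<dots> \<le> b * real n"
      using mult_right_mono[OF mle, of "real K + 1"] by (simp add: b_def mult_ac)
    also have "\<dots> < 2 powr (\<eta> * real n - 2)" by (rule n(1))
    also have "\<dots> \<le> 2 powr (real (m n - r n - 1))"
      using rm 2 by (intro powr_mono) auto
    also have "\<dots> = real (2 ^ (m n - r n - 1))" by (simp add: powr_realpow)
    finally have "r n + m n * K < 2 ^ (m n - r n - 1)" unfolding of_nat_less_iff .
    with 1 2 show ?thesis by blast
  qed
  then show ?thesis by (intro exI[of _ n0]) (auto simp: n0_def)
qed

lemma many_primes_in_window:
  assumes "r < m" "r + m * K < 2 ^ (m - r - 1)"
  obtains A :: "'k::{field_gcd,finite_field} poly set" where "finite A" "card A = K"
    "\<And>P. P \<in> A \<Longrightarrow> prime P \<and> r < degree P \<and> degree P \<le> m"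
proof -
  let ?q = "CARD('k)"
  have q: "2 \<le> ?q" using one_less_card_field[where 'a = 'k] by simp
  have "m > 0" using assms(1) by simp
  then obtain A :: "'k poly set" where A: "finite A"
    "\<And>P. P \<in> A \<Longrightarrow> prime P \<and> r < degree P \<and> degree P \<le> m"
    "?q ^ m \<le> r * ?q ^ (r + 1) + m * card A"
    using many_primes[of m r] by metis
  have "K \<le> card A"
  proof (rule ccontr)
    assume "\<not> K \<le> card A"
    then have "m * card A \<le> m * K" by simp
    also have "\<dots> \<le> ?q ^ (r + 1) * (m * K)" using q by simp
    finally have "?q ^ m \<le> r * ?q ^ (r + 1) + ?q ^ (r + 1) * (m * K)" using A(3) by linarith
    also have "\<dots> = ?q ^ (r + 1) * (r + m * K)" by (simp add: algebra_simps)
    also have "\<dots> < ?q ^ (r + 1) * ?q ^ (m - r - 1)"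
    proof (rule mult_strict_left_mono)
      have "(2 :: nat) ^ (m - r - 1) \<le> ?q ^ (m - r - 1)" using q by (intro power_mono) auto
      then show "r + m * K < ?q ^ (m - r - 1)" using assms(2) by linarith
    qed (use q in simp)
    also have "\<dots> = ?q ^ (r + 1 + (m - r - 1))" by (simp only: power_add)
    also have "\<dots> = ?q ^ m" using assms(1) by simp
    finally show False by simp
  qed
  then obtain B where "B \<subseteq> A" "card B = K" by (metis obtain_subset_with_card_n)
  then show ?thesis using A that[of B] finite_subset by blast
qed

text \<open>The \<open>c\<close> and \<open>n0\<close> constructed here are built from
  \<open>d\<close> and \<open>\<epsilon>\<close> alone; the size of the field enters only through
  the power.\<close>

lemma card_curve_points_separable:
  fixes d :: nat and \<epsilon> :: real
  assumes d: "d \<ge> 1" and \<epsilon>: "\<epsilon> > 0"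
  shows "\<exists>c n0. \<forall>(F :: 'k::{field_gcd,finite_field} poly poly poly) a n.
    n0 \<le> n \<longrightarrow> y_regular F d a \<longrightarrow> pderiv F \<noteq> 0 \<longrightarrow>
    real (card (curve_points F n)) \<le> real c * real CARD('k) powr ((1 / d + \<epsilon>) * n)"
proof -
  define \<eta> where "\<eta> = \<epsilon> / 2"
  have \<eta>: "\<eta> > 0" using \<epsilon> by (simp add: \<eta>_def)
  define E where "E = 2 * d ^ 2 + 1"
  \<comment> \<open>By the height bound, \<open>h * n\<close> bounds the degree of
    \<open>a * eval2 (pderiv F) x y\<close>. As \<open>n \<le> d * r n\<close>, this is less than
    \<open>K * r n\<close>, so \<open>K\<close> primes of degree above \<open>r n\<close> cannot all
    divide it.\<close>
  define h where "h = 8 * E ^ 3 + 2 * d"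
  define K where "K = h * d + 1"
  define A where "A = nat \<lceil>(d + \<eta>) / (\<eta> * d)\<rceil> + 1"
  have A: "A > 0" by (simp add: A_def)
  define r where "r n = nat \<lfloor>(1 / d + \<eta>) * real n\<rfloor>" for n
  define m where "m n = nat \<lfloor>(1 / d + 2 * \<eta>) * real n\<rfloor>" for n
  obtain n0 where n0: "n0 > 0"
    "\<And>n. n \<ge> n0 \<Longrightarrow> n \<le> d * r n \<and> r n < m n \<and> r n + m n * K < 2 ^ (m n - r n - 1)"
    using eventually_parameters[OF \<eta> d, of K] unfolding r_def m_def by blast
  define B1 where "B1 = d * (d * d + d * d)"
  define B2 where "B2 = d * (d * (d * d + d * A))"
  \<comment> \<open>The summands account for curves with few points, for zeros of the
    \<open>Y\<close>-derivative, and for the nonsingular points modulo each of at most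
    \<open>K\<close> primes.\<close>
  define c where "c = E ^ 2 + B1 + K * B2"
  have main: "card (curve_points F n) \<le> c * CARD('k) ^ m n"
    if n: "n \<ge> n0" and F: "y_regular F d a" and sep: "pderiv F \<noteq> 0"
    for F :: "'k poly poly poly" and a n
  proof -
    let ?q = "CARD('k)"
    have qm: "1 \<le> ?q ^ m n" by simp
    have npos: "n > 0" using n n0(1) by simp
    note par = n0(2)[OF n]
    have r0: "r n > 0" using par npos by (cases "r n") auto
    show ?thesis
    proof (cases "E ^ 2 - 1 \<le> card (curve_points F n)")
      case False
      then have "card (curve_points F n) \<le> c * 1" by (simp add: c_def)
      also have "\<dots> \<le> c * ?q ^ m n" using qm by (intro mult_left_mono) auto
      finally show ?thesis .
    next
      case True
      have hF: "height F \<le> 4 * E ^ 3 * n"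
        using height_le_if_many_points[OF F] True by (simp add: E_def)
      obtain \<P> :: "'k poly set" where \<P>: "finite \<P>" "card \<P> = K"
        "\<And>P. P \<in> \<P> \<Longrightarrow> prime P \<and> r n < degree P \<and> degree P \<le> m n"
        using many_primes_in_window[of "r n" "m n" K] par by metis
      define Z where "Z = {(x, y) \<in> curve_points F n. eval2 (pderiv F) x y = 0}"
      define \<Q> where "\<Q> = {P \<in> \<P>. \<not> P dvd a}"
      define T where "T P = {(x, y) \<in> curve_points F n. \<not> P dvd eval2 (pderiv F) x y}" for P
      have degpd: "degree (pderiv F) < d"
        using F degree_pderiv_le[of F] d by (simp add: y_regular_def)
      have Z: "card Z \<le> B1"
        unfolding B1_def
      proof (rule y_regular_card_common_zeros(2)[OF F])
        show "\<not> F dvd pderiv F" using F sep degpd by (rule y_regular_not_dvd)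
        show "degree (pderiv F) < d" by (rule degpd)
        show "degree (coeff (pderiv F) j) \<le> d" for j
        proof -
          have "degree (coeff (pderiv F) j) \<le> degree (coeff F (Suc j))"
            by (simp add: coeff_pderiv of_nat_poly del: of_nat_Suc)
          also have "\<dots> \<le> d" using F tdeg_leD_degree(2)[of F d "Suc j"] by (simp add: y_regular_def)
          finally show ?thesis .
        qed
      qed (auto simp: Z_def curve_points_def)
      have T: "card (T P) \<le> ?q ^ m n * B2" if "P \<in> \<Q>" for P
      proof -
        have P: "prime P" "\<not> P dvd a" "r n < degree P" "degree P \<le> m n"
          using that \<P>(3) by (auto simp: \<Q>_def)
        have "card (T P) \<le> ?q ^ degree P * d * (d * (d * d + d * A))"
          unfolding T_def
        proof (rule card_points_nonsingular_mod_prime_le[OF F P(1,2) A])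
          have "(1 / d + \<eta>) * real n < real (degree P)"
            using P(3) unfolding r_def by linarith
          moreover have "(d + \<eta>) / (\<eta> * d) < real A" unfolding A_def by linarith
          ultimately have "real n * (real A + real d - 2) < real (degree P) * (real d * real A - 1)"
            using d npos \<eta> by (intro window_inequality) auto
          then show "(\<Sum>k<d * A. degree P * (d * A - k))
              < (\<Sum>(i, j)\<in>{..<A} \<times> {..<d}. d * A * degree P - (i + j) * n)"
            using A d by (intro parameter_count) auto
        qed
        also have "\<dots> = ?q ^ degree P * B2" by (simp add: B2_def)
        also have "\<dots> \<le> ?q ^ m n * B2"
          using P(4) one_less_card_field[where 'a = 'k]
          by (intro mult_right_mono power_increasing) auto
        finally show ?thesis .
      qed
      have fin: "finite (curve_points F n)" by (rule finite_curve_points)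
      have cover: "curve_points F n \<subseteq> Z \<union> (\<Union>P\<in>\<Q>. T P)"
      proof clarify
        fix x y assume xy: "(x, y) \<in> curve_points F n" "(x, y) \<notin> (\<Union>P\<in>\<Q>. T P)"
        show "(x, y) \<in> Z"
        proof (rule ccontr)
          assume "(x, y) \<notin> Z"
          then have W: "a * eval2 (pderiv F) x y \<noteq> 0"
            using xy(1) y_regular_nz[OF F] by (simp add: Z_def)
          have "degree (a * eval2 (pderiv F) x y) \<le> 2 * height F + 2 * d * n"
            using xy(1) by (intro degree_lead_coeff_pderiv_le[OF F]) (auto simp: curve_points_def)
          also have "\<dots> \<le> h * n" using hF by (simp add: h_def algebra_simps)
          also have "\<dots> \<le> h * (d * r n)" using par by (intro mult_left_mono) auto
          also have "\<dots> < r n * K" using r0 by (simp add: K_def algebra_simps)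
          finally have "degree (a * eval2 (pderiv F) x y) < r n * card \<P>" by (simp add: \<P>(2))
          then obtain P where P: "P \<in> \<P>" "\<not> P dvd a * eval2 (pderiv F) x y"
            using prime_not_dvd[OF W \<P>(1), of "r n"] \<P>(3) by (meson less_imp_le)
          then have "P \<in> \<Q>" "(x, y) \<in> T P" using xy(1) by (auto simp: \<Q>_def T_def)
          with xy(2) show False by blast
        qed
      qed
      have \<Q>: "finite \<Q>" "card \<Q> \<le> K"
        using \<P>(1,2) card_mono[of \<P> \<Q>] by (auto simp: \<Q>_def)
      have finT: "finite (T P)" "finite Z" for P
        using fin by (auto simp: T_def Z_def intro: rev_finite_subset)
      have "card (curve_points F n) \<le> card (Z \<union> (\<Union>P\<in>\<Q>. T P))"
        using cover finT \<Q>(1) by (intro card_mono) auto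
      also have "\<dots> \<le> card Z + card (\<Union>P\<in>\<Q>. T P)" by (rule card_Un_le)
      also have "card (\<Union>P\<in>\<Q>. T P) \<le> (\<Sum>P\<in>\<Q>. card (T P))" using \<Q>(1) by (rule card_UN_le)
      also have "\<dots> \<le> card \<Q> * (?q ^ m n * B2)" using T by (intro sum_bounded_above[THEN order_trans]) auto
      also have "\<dots> \<le> K * (?q ^ m n * B2)" using \<Q>(2) by (rule mult_right_mono) simp
      also have "card Z + K * (?q ^ m n * B2) \<le> B1 * ?q ^ m n + K * B2 * ?q ^ m n"
        using Z qm by (intro add_mono) (auto intro: order_trans)
      also have "\<dots> \<le> c * ?q ^ m n" unfolding c_def by (simp add: add_mult_distrib)
      finally show ?thesis by simp
    qed
  qed
  show ?thesis
  proof (rule exI[of _ c], rule exI[of _ n0], intro allI impI)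
    fix F :: "'k poly poly poly" and a n
    assume *: "n0 \<le> n" "y_regular F d a" "pderiv F \<noteq> 0"
    have q: "1 < real CARD('k)" using one_less_card_field[where 'a = 'k] by simp
    have "real (card (curve_points F n)) \<le> real (c * CARD('k) ^ m n)"
      using main[OF *] by (simp only: of_nat_le_iff)
    also have "\<dots> = real c * real CARD('k) powr real (m n)"
      using q by (simp add: powr_realpow)
    also have "\<dots> \<le> real c * real CARD('k) powr ((1 / d + \<epsilon>) * n)"
    proof (intro mult_left_mono powr_mono)
      have "0 \<le> (1 / d + 2 * \<eta>) * real n" using \<eta> by simp
      then have "real (m n) \<le> (1 / d + 2 * \<eta>) * real n" unfolding m_def by linarith
      then show "real (m n) \<le> (1 / d + \<epsilon>) * real n" by (simp add: \<eta>_def)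
    qed (use q in auto)
    finally show "real (card (curve_points F n)) \<le> real c * real CARD('k) powr ((1 / d + \<epsilon>) * n)" .
  qed
qed

text \<open>At most \<open>d + 1\<close> values of \<open>l\<close> are bad: the roots of the top
  homogeneous part at \<open>(l, 1)\<close>, and one value that may kill the
  \<open>Y\<close>-derivative. Since F_q may have too few elements, \<open>l\<close> is taken from
  F_q[T], with degree bounded in terms of \<open>d\<close>.\<close>

lemma y_regular_shear:
  fixes F :: "'k::{field_gcd,finite} poly poly poly"
  assumes F: "irreducible F" "total_degree2 F = d" and d: "d \<ge> 1"
  obtains l a where "degree l \<le> d + 1" "y_regular (shear l F) d a"
    "pderiv (shear l F) = 0 \<longrightarrow> pderiv F = 0 \<and> map_poly pderiv F = 0"
proof -
  have tdeg: "tdeg_le F d" using F(2) by (simp add: tdeg_le_iff)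
  obtain j where j: "j \<le> d" "coeff (coeff F j) (d - j) \<noteq> 0"
    using total_degree2_attained[OF F(2) d] by metis
  define f where "f = (\<Sum>j\<le>d. monom (coeff (coeff F j) (d - j)) (d - j))"
  have "coeff f (d - j) = (\<Sum>i\<le>d. if i = j then coeff (coeff F j) (d - j) else 0)"
    unfolding f_def coeff_sum using j(1) by (intro sum.cong) auto
  also have "\<dots> \<noteq> 0" using j by simp
  finally have f0: "f \<noteq> 0" by auto
  have degf: "degree f \<le> d"
    unfolding f_def by (intro degree_sum_le) (auto intro: order_trans[OF degree_monom_le])
  define B1 where "B1 = {l. poly f l = 0}"
  \<comment> \<open>If the \<open>X\<close>-derivative is zero, then \<open>l\<close> has no
    influence on whether the sum vanishes; if it is nonzero, the relation determines
    \<open>l\<close>.\<close>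
  define B2 where "B2 = {l. smult [:l:] (map_poly pderiv F) + pderiv F = 0 \<and> map_poly pderiv F \<noteq> 0}"
  have B1: "finite B1" "card B1 \<le> d"
    using f0 degf card_poly_roots_bound[OF f0] by (auto simp: B1_def poly_roots_finite)
  have "l = l'" if "l \<in> B2" "l' \<in> B2" for l l'
  proof -
    have "smult [:l:] (map_poly pderiv F) = smult [:l':] (map_poly pderiv F)"
      using that unfolding B2_def by (metis (mono_tags, lifting) add_right_cancel mem_Collect_eq)
    then have "smult ([:l:] - [:l':]) (map_poly pderiv F) = 0"
      by (simp only: smult_diff_left diff_self)
    then show ?thesis using that by (auto simp: B2_def)
  qed
  then have B2: "finite B2" "card B2 \<le> 1"
    by (metis finite.simps is_singletonI' is_singleton_the_elem finite_insert finite.emptyI)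
      (metis \<open>\<And>l' l. l \<in> B2 \<Longrightarrow> l' \<in> B2 \<Longrightarrow> l = l'\<close> card_le_Suc0_iff_eq card.infinite One_nat_def zero_le)
  have "card (B1 \<union> B2) \<le> d + 1" using card_Un_le[of B1 B2] B1 B2 by linarith
  also have "d + 1 < card (poly_box (d + 1) :: 'k poly set)"
  proof -
    have "d + 1 < 2 ^ (d + 1)" by (rule less_exp)
    also have "\<dots> \<le> CARD('k) ^ (d + 1)"
      using one_less_card_field[where 'a = 'k] by (intro power_mono) auto
    also have "\<dots> \<le> CARD('k) ^ (d + 1 + 1)" by (intro power_increasing) simp_all
    finally show ?thesis by (simp only: card_poly_box)
  qed
  finally have "\<not> poly_box (d + 1) \<subseteq> B1 \<union> B2"
    using card_mono[of "B1 \<union> B2" "poly_box (d + 1)"] B1(1) B2(1) by auto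
  then obtain l where l: "degree l \<le> d + 1" "l \<notin> B1" "l \<notin> B2" by (auto simp: poly_box_def)
  let ?F = "shear l F"
  have tdeg': "tdeg_le ?F d" using tdeg by (rule tdeg_le_shear)
  define a where "a = coeff (coeff ?F d) 0"
  have "a = poly f l"
    by (simp add: a_def coeff_shear f_def poly_sum poly_monom)
  then have a0: "a \<noteq> 0" using l(2) by (simp add: B1_def)
  have "degree (coeff ?F d) = 0" using tdeg_leD_degree(2)[OF tdeg', of d] by simp
  then have coeff: "coeff ?F d = [:a:]" by (auto simp: a_def elim: degree_eq_zeroE)
  then have "degree ?F = d"
    using a0 tdeg_leD_degree(1)[OF tdeg'] by (intro antisym le_degree) auto
  moreover have "prime_elem ?F" using F(1) by (intro prime_elem_shear irreducible_imp_prime_elem)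
  ultimately have reg: "y_regular ?F d a" using d tdeg' coeff by (simp add: y_regular_def)
  have "pderiv ?F = shear l (smult [:l:] (map_poly pderiv F) + pderiv F)"
    by (simp only: pderiv_shear shear_add shear_smult_const)
  then have "pderiv F = 0 \<and> map_poly pderiv F = 0" if "pderiv ?F = 0"
    using that l(3) by (auto simp: shear_eq_0_iff B2_def)
  then show ?thesis using that l(1) reg by blast
qed

lemma card_curve_points_shear:
  fixes F :: "'k::{field,finite} poly poly poly"
  assumes "degree l \<le> e"
  shows "card (curve_points F n) \<le> card (curve_points (shear l F) (n + e))"
proof (rule card_inj_on_le)
  show "inj_on (\<lambda>(x, y). (x - l * y, y)) (curve_points F n)" by (auto simp: inj_on_def)
  show "(\<lambda>(x, y). (x - l * y, y)) ` curve_points F n \<subseteq> curve_points (shear l F) (n + e)"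
  proof clarify
    fix x y assume xy: "(x, y) \<in> curve_points F n"
    have "degree (l * y) \<le> n + e"
      using degree_mult_le[of l y] assms xy by (simp add: curve_points_def poly_box_def)
    then have "degree (x - l * y) \<le> n + e"
      using xy by (intro degree_diff_le) (auto simp: curve_points_def poly_box_def)
    then show "(x - l * y, y) \<in> curve_points (shear l F) (n + e)"
      using xy by (simp add: curve_points_def poly_box_def eval2_shear)
  qed
qed (rule finite_curve_points)

lemma card_curve_points_inseparable:
  fixes F :: "'k::{field_gcd,finite} poly poly poly"
  assumes F: "irreducible F" "total_degree2 F = d"
    and sh: "y_regular (shear l F) d a" and pd: "pderiv F = 0" "map_poly pderiv F = 0"
  shows "card (curve_points (shear l F) n) \<le> d * ((d + 1) * d + d * d)"
proof -
  have "tdeg_le F d" using F(2) by (simp add: tdeg_le_iff)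
  then obtain G where
    G: "tdeg_le G d" "\<not> F dvd G" "\<And>x y. eval2 F x y = 0 \<Longrightarrow> eval2 G x y = 0"
    using inseparable_second_curve[OF F(1) _ pd] by blast
  have t: "tdeg_le (shear l G) d" using G(1) by (rule tdeg_le_shear)
  show ?thesis
  proof (rule y_regular_card_common_zeros(2)[OF sh])
    show "\<not> shear l F dvd shear l G" using G(2) by (simp add: shear_dvd_iff)
    show "degree (shear l G) < d + 1" using tdeg_leD_degree(1)[OF t] by simp
    show "degree (coeff (shear l G) j) \<le> d" for j using tdeg_leD_degree(2)[OF t, of j] by simp
    show "curve_points (shear l F) n \<subseteq> {(x, y). eval2 (shear l F) x y = 0 \<and> eval2 (shear l G) x y = 0}"
      using G(3) by (auto simp: curve_points_def eval2_shear)
  qed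
qed

lemma card_curve_points_le_square:
  "card (curve_points (F :: 'k::{field,finite} poly poly poly) n) \<le> CARD('k) ^ (2 * (n + 1))"
proof -
  let ?B = "poly_box n :: 'k poly set"
  have "card (curve_points F n) \<le> card (?B \<times> ?B)"
    by (intro card_mono) (auto simp: curve_points_def finite_poly_box)
  also have "\<dots> = CARD('k) ^ (2 * (n + 1))"
    by (simp add: card_cartesian_product card_poly_box mult_2 flip: power_add)
  finally show ?thesis .
qed

lemma bombieri_pila_field_gcd:
  fixes d :: nat and \<epsilon> :: real
  assumes d: "d \<ge> 1" and \<epsilon>: "\<epsilon> > 0"
  shows "\<exists>c>0. \<forall>(F :: 'k::{field_gcd,finite_field} poly poly poly) (n :: nat).
    irreducible F \<and> total_degree2 F = d \<longrightarrow>
      real (card (curve_points F n))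
        \<le> c * (real CARD('k) ^ (n + 1)) powr (1 / real d + \<epsilon>)"
proof -
  let ?q = "real CARD('k)"
  define s where "s = 1 / real d + \<epsilon>"
  have s: "s > 0" using d \<epsilon> by (simp add: s_def add_pos_pos)
  have q: "?q > 1" using one_less_card_field[where 'a = 'k] by simp
  have pw: "(?q ^ (n + 1)) powr s = ?q powr (s * (n + 1))" for n
  proof -
    have "?q ^ (n + 1) = ?q powr real (n + 1)" using q by (subst powr_realpow) auto
    then show ?thesis by (simp only: powr_powr mult.commute)
  qed
  have ge1: "1 \<le> (?q ^ (n + 1)) powr s" for n
    unfolding pw using q s by (intro ge_one_powr_ge_zero) auto
  obtain c n0 where c: "\<And>(F :: 'k poly poly poly) a n. n0 \<le> n \<Longrightarrow> y_regular F d a \<Longrightarrow> pderiv F \<noteq> 0 \<Longrightarrow>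
    real (card (curve_points F n)) \<le> real c * ?q powr (s * n)"
    using card_curve_points_separable[where 'k = 'k, OF d \<epsilon>] unfolding s_def by metis
  \<comment> \<open>For \<open>n < n0\<close> the trivial bound by the whole square is absorbed
    here. \<open>C1\<close> and \<open>C2\<close> depend on the size of the fixed field, but not on
    \<open>F\<close> or \<open>n\<close>.\<close>
  define C1 where "C1 = ?q ^ (2 * (n0 + 1))"
  \<comment> \<open>The shear enlarges the box from \<open>n\<close> to \<open>n + (d + 1)\<close>;
    compared with the \<open>n + 1\<close> in the target exponent the excess is
    \<open>d\<close>.\<close>
  define C2 where "C2 = real c * ?q powr (s * d)"
  define C3 where "C3 = real (d * ((d + 1) * d + d * d))"
  have C: "C1 > 0" "C2 \<ge> 0" "C3 \<ge> 0" using q by (simp_all add: C1_def C2_def C3_def)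
  have "real (card (curve_points F n)) \<le> (C1 + C2 + C3) * (?q ^ (n + 1)) powr s"
    if F: "irreducible F" "total_degree2 F = d" for F :: "'k poly poly poly" and n
  proof -
    let ?X = "(?q ^ (n + 1)) powr s"
    have "real (card (curve_points F n)) \<le> C1 * ?X \<or> real (card (curve_points F n)) \<le> C2 * ?X
      \<or> real (card (curve_points F n)) \<le> C3 * ?X"
    proof (cases "n0 \<le> n")
      case False
      have "real (card (curve_points F n)) \<le> real (CARD('k) ^ (2 * (n + 1)))"
        using card_curve_points_le_square[of F n] by (simp only: of_nat_le_iff)
      also have "\<dots> = ?q ^ (2 * (n + 1))" by simp
      also have "\<dots> \<le> C1"
        unfolding C1_def using q False by (intro power_increasing) auto
      also have "C1 * 1 \<le> C1 * ?X" using C(1) ge1 by (intro mult_left_mono) auto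
      finally show ?thesis by simp
    next
      case True
      obtain l a where l: "degree l \<le> d + 1" and reg: "y_regular (shear l F) d a"
        and insep: "pderiv (shear l F) = 0 \<longrightarrow> pderiv F = 0 \<and> map_poly pderiv F = 0"
        using y_regular_shear[OF F d] by metis
      let ?N = "n + (d + 1)"
      have le: "real (card (curve_points F n)) \<le> real (card (curve_points (shear l F) ?N))"
        using card_curve_points_shear[OF l, of F n] by simp
      show ?thesis
      proof (cases "pderiv (shear l F) = 0")
        case False
        have "real (card (curve_points (shear l F) ?N)) \<le> real c * ?q powr (s * real ?N)"
          using True by (intro c[OF _ reg False]) simp
        also have "s * real ?N = s * real d + s * real (n + 1)" by (simp add: algebra_simps)
        also have "real c * ?q powr (s * real d + s * real (n + 1)) = C2 * ?X"
          by (simp only: C2_def pw powr_add mult.assoc)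
        finally show ?thesis using le by simp
      next
        case True
        then have "real (card (curve_points (shear l F) ?N)) \<le> C3"
          using card_curve_points_inseparable[OF F reg, of ?N] insep
          unfolding C3_def by (simp only: of_nat_le_iff)
        also have "C3 * 1 \<le> C3 * ?X" using C(3) ge1 by (intro mult_left_mono) auto
        finally show ?thesis using le by simp
      qed
    qed
    moreover have "C1 * ?X \<le> (C1 + C2 + C3) * ?X" "C2 * ?X \<le> (C1 + C2 + C3) * ?X"
      "C3 * ?X \<le> (C1 + C2 + C3) * ?X"
      using C by (intro mult_right_mono; simp)+
    ultimately show ?thesis by linarith
  qed
  then show ?thesis using C unfolding s_def by (intro exI[of _ "C1 + C2 + C3"]) auto
qed

section \<open>Transfer to arbitrary finite fields\<close>

text \<open>Passing to \<open>map_poly\<close> gives an isomorphism again, so one isomorphism of the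
  constants carries irreducibility, total degree and evaluation through all three polynomial
  layers.\<close>

locale ring_isomorphism =
  fixes \<phi> :: "'a::comm_ring_1 \<Rightarrow> 'b::comm_ring_1"
  assumes add: "\<phi> (x + y) = \<phi> x + \<phi> y" and mult: "\<phi> (x * y) = \<phi> x * \<phi> y" and one: "\<phi> 1 = 1"
    and bij: "bij \<phi>"
begin

lemma zero [simp]: "\<phi> 0 = 0"
  using add[of 0 0] by simp

lemma eq_0_iff [simp]: "\<phi> x = 0 \<longleftrightarrow> x = 0"
  using bij by (metis bij_pointE zero)

lemma dvd_1_iff: "\<phi> x dvd 1 \<longleftrightarrow> x dvd 1"
  using bij mult one unfolding dvd_def by (metis bij_pointE)

lemma irreducible: "irreducible x \<Longrightarrow> irreducible (\<phi> x)"
  using bij mult dvd_1_iff unfolding irreducible_def by (metis bij_pointE eq_0_iff)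

lemma coeff_map [simp]: "coeff (map_poly \<phi> p) i = \<phi> (coeff p i)"
  by (simp add: coeff_map_poly)

lemma sum: "\<phi> (sum f A) = (\<Sum>x\<in>A. \<phi> (f x))"
  by (induction A rule: infinite_finite_induct) (simp_all add: add)

lemma poly_map: "poly (map_poly \<phi> p) (\<phi> x) = \<phi> (poly p x)"
  by (induction p) (simp_all add: map_poly_pCons add mult)

lemma degree_map [simp]: "degree (map_poly \<phi> p) = degree p"
  by (rule degree_map_poly) simp

lemma ring_isomorphism_map_poly: "ring_isomorphism (map_poly \<phi>)"
proof
  show "map_poly \<phi> (p + q) = map_poly \<phi> p + map_poly \<phi> q" for p q
    by (simp add: poly_eq_iff add)
  show "map_poly \<phi> (p * q) = map_poly \<phi> p * map_poly \<phi> q" for p q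
    by (simp add: poly_eq_iff coeff_mult sum mult)
  show "map_poly \<phi> 1 = 1"
    by (simp add: poly_eq_iff one)
  show "bij (map_poly \<phi>)"
  proof (rule bijI)
    show "inj (map_poly \<phi>)"
      using bij by (auto simp: inj_on_def poly_eq_iff bij_def)
    show "surj (map_poly \<phi>)"
    proof (rule surjI)
      fix p
      define \<psi> where "\<psi> = the_inv \<phi>"
      have \<psi>: "\<phi> (\<psi> x) = x" for x
        using bij by (simp add: \<psi>_def f_the_inv_into_f_bij_betw)
      then have "\<psi> 0 = 0" using eq_0_iff by metis
      then show "map_poly \<phi> (map_poly \<psi> p) = p"
        by (simp add: poly_eq_iff coeff_map_poly \<psi>)
    qed
  qed
qed

lemma eval2_map: "eval2 (map_poly (map_poly \<phi>) F) (\<phi> x) (\<phi> y) = \<phi> (eval2 F x y)"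
  by (induction F) (simp_all add: map_poly_pCons poly_map add mult)

lemma total_degree2_map: "total_degree2 (map_poly (map_poly \<phi>) F) = total_degree2 F"
  by (simp add: total_degree2_def coeff_map_poly)

end

interpretation gcd_field: ring_isomorphism "Abs_gcd_field :: 'a::field \<Rightarrow> 'a gcd_field"
proof
  show "bij (Abs_gcd_field :: 'a \<Rightarrow> 'a gcd_field)"
    by (metis Abs_gcd_field_inverse Rep_gcd_field_inverse UNIV_I bijI' )
qed (simp_all add: plus_gcd_field.abs_eq times_gcd_field.abs_eq one_gcd_field_def)

interpretation gcd_field_poly: ring_isomorphism "map_poly Abs_gcd_field :: 'a::field poly \<Rightarrow> 'a gcd_field poly"
  by (rule gcd_field.ring_isomorphism_map_poly)

interpretation gcd_field_poly3: ring_isomorphism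
  "map_poly (map_poly (map_poly Abs_gcd_field)) :: 'a::field poly poly poly \<Rightarrow> 'a gcd_field poly poly poly"
  by (intro ring_isomorphism.ring_isomorphism_map_poly gcd_field.ring_isomorphism_axioms)

lemma CARD_gcd_field: "CARD('a::field gcd_field) = CARD('a)"
  by (rule bij_betw_same_card[OF gcd_field.bij, symmetric])

theorem theorem1:
  fixes d :: nat and \<epsilon> :: real
  assumes "d \<ge> 1" and "\<epsilon> > 0"
  shows "\<exists>c>0. \<forall>(F :: 'k::{field,finite} poly poly poly) (n :: nat).
    irreducible F \<and> total_degree2 F = d \<longrightarrow>
      real (card (curve_points F n))
        \<le> c * real (card (poly_box n :: 'k poly set)) powr (1 / real d + \<epsilon>)"
proof -
  obtain c where "c > 0" and c: "\<And>(F :: 'k gcd_field poly poly poly) n.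
    irreducible F \<Longrightarrow> total_degree2 F = d \<Longrightarrow> real (card (curve_points F n))
        \<le> c * (real CARD('k gcd_field) ^ (n + 1)) powr (1 / real d + \<epsilon>)"
    using bombieri_pila_field_gcd[OF assms, where 'k = "'k gcd_field"] by blast
  have "real (card (curve_points F n))
        \<le> c * real (card (poly_box n :: 'k poly set)) powr (1 / real d + \<epsilon>)"
    if F: "irreducible F" "total_degree2 F = d" for F :: "'k poly poly poly" and n
  proof -
    let ?\<phi> = "map_poly Abs_gcd_field :: 'k poly \<Rightarrow> 'k gcd_field poly"
    let ?F = "map_poly (map_poly ?\<phi>) F"
    have "card (curve_points F n) \<le> card (curve_points ?F n)"
    proof (rule card_inj_on_le)
      show "inj_on (\<lambda>(x, y). (?\<phi> x, ?\<phi> y)) (curve_points F n)"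
        using gcd_field_poly.bij by (auto simp: inj_on_def bij_def)
      show "(\<lambda>(x, y). (?\<phi> x, ?\<phi> y)) ` curve_points F n \<subseteq> curve_points ?F n"
        by (auto simp: curve_points_def poly_box_def gcd_field_poly.eval2_map)
    qed (rule finite_curve_points)
    moreover have "irreducible ?F" using F(1) by (rule gcd_field_poly3.irreducible)
    moreover have "total_degree2 ?F = d" using F(2) by (simp only: gcd_field_poly.total_degree2_map)
    ultimately show ?thesis
      using c[of ?F n] by (simp add: card_poly_box CARD_gcd_field)
  qed
  with \<open>c > 0\<close> show ?thesis by blast
qed

end
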